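(* Let $n\ge 1$, $s\in(0,1)$, let $\Omega\subset\mathbb{R}^n$ be an open bounded set with Lipschitz boundary, and let $K:\mathbb{R}^n\times\mathbb{R}^n\to[0,+\infty]$ be a measurable kernel satisfying, for some $c,C\in(0,+\infty)$ and $\varrho\in(0,+\infty]$, $$\frac{c\,\chi_{[0,\varrho)}(|x-z|)}{|x-z|^{n+2s}}\le K(x,z)\le \frac{C}{|x-z|^{n+2s}}\quad\text{and}\quad K(x,z)=K(z,x)\qquad\text{for all }x,z\in\mathbb{R}^n .$$ Let $h:\mathbb{R}\to\mathbb{R}$ be continuous, odd and strictly increasing, and let $\gamma:=\lim_{t\to+\infty}h(t)\in(0,+\infty]$. Let $a,f\in L^1(\Omega)$ and assume there exists $Q\in(0,\gamma)$ such that $|f(x)|\le Q\,a(x)$ for a.e. $x\in\Omega$. Then there exists a unique weak solution $u\in H^s_0(\Omega)\cap L^\infty(\Omega)$ of $$\mathcal L_K u+a\,h(u)=f\ \text{ in }\Omega,\qquad u=0\ \text{ in }\mathbb{R}^n\setminus\Omega .$$ Moreover, $$\|u\|_{L^\infty(\Omega)}\le h^{-1}(Q)\quad\text{and}\quad \iint_{\mathbb{R}^n\times\mathbb{R}^n}\big(u(x)-u(z)\big)^2K(x,z)\,dx\,dz\le 2h^{-1}(Q)\big(\|f\|_{L^1(\Omega)}+Q\|a\|_{L^1(\Omega)}\big).$$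
   Context: $\chi_{[0,\varrho)}$ is the indicator function of $[0,\varrho)$. $H^s(\mathbb{R}^n)$ is the space of $u\in L^2(\mathbb{R}^n)$ with $\iint_{\mathbb{R}^n\times\mathbb{R}^n}\frac{|u(x)-u(y)|^2}{|x-y|^{n+2s}}dx\,dy<\infty$, and $H^s_0(\Omega)=\{u\in H^s(\mathbb{R}^n):u=0 \text{ a.e. in }\mathbb{R}^n\setminus\Omega\}$. The operator is $\mathcal L_K u(x)=\mathrm{P.V.}\int_{\mathbb{R}^n}(u(x)-u(z))K(x,z)\,dz$. A weak solution of the problem is a function $u\in H^s_0(\Omega)$ such that for every $v\in H^s_0(\Omega)\cap L^\infty(\Omega)$, $$\frac12\iint_{\mathbb{R}^n\times\mathbb{R}^n}(u(x)-u(z))(v(x)-v(z))K(x,z)\,dx\,dz+\int_\Omega a\,h(u)\,v\,dx=\int_\Omega f\,v\,dx.$$ $h^{-1}$ denotes the inverse of $h$ on $(-\gamma,\gamma)$. *)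

theory Defs
  imports "HOL-Analysis.Analysis"
begin

definition lipschitz_boundary :: "'a::euclidean_space set \<Rightarrow> bool" where
  "lipschitz_boundary \<Omega> \<longleftrightarrow>
     (\<forall>x0 \<in> frontier \<Omega>. \<exists>r>0. \<exists>e::'a. \<exists>g::'a \<Rightarrow> real. \<exists>L.
        norm e = 1 \<and> L-lipschitz_on {y. y \<bullet> e = 0} g \<and>
        \<Omega> \<inter> ball x0 r = {x \<in> ball x0 r. g (x - (x \<bullet> e) *\<^sub>R e) < x \<bullet> e})"

definition Hs :: "real \<Rightarrow> ('a::euclidean_space \<Rightarrow> real) set" where
  "Hs s = {u. u \<in> borel_measurable lebesgue \<and> integrable lebesgue (\<lambda>x. (u x)\<^sup>2) \<and>
     (\<integral>\<^sup>+ p. ennreal ((u (fst p) - u (snd p))\<^sup>2 / norm (fst p - snd p) powr (real DIM('a) + 2 * s))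
        \<partial>(lebesgue :: ('a \<times> 'a) measure)) < \<infinity>}"

definition Hs0 :: "real \<Rightarrow> 'a::euclidean_space set \<Rightarrow> ('a \<Rightarrow> real) set" where
  "Hs0 s \<Omega> = {u \<in> Hs s. AE x in lebesgue. x \<notin> \<Omega> \<longrightarrow> u x = 0}"

definition Linf :: "'a::euclidean_space set \<Rightarrow> ('a \<Rightarrow> real) set" where
  "Linf \<Omega> = {u. u \<in> borel_measurable lebesgue \<and> (\<exists>B. AE x in lebesgue. x \<in> \<Omega> \<longrightarrow> \<bar>u x\<bar> \<le> B)}"

definition weak_solution ::
  "real \<Rightarrow> ('a::euclidean_space \<Rightarrow> 'a \<Rightarrow> real) \<Rightarrow> ('a \<Rightarrow> real) \<Rightarrow> (real \<Rightarrow> real) \<Rightarrow>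
   ('a \<Rightarrow> real) \<Rightarrow> 'a set \<Rightarrow> ('a \<Rightarrow> real) \<Rightarrow> bool" where
  "weak_solution s K a h f \<Omega> u \<longleftrightarrow> u \<in> Hs0 s \<Omega> \<and>
     (\<forall>v \<in> Hs0 s \<Omega> \<inter> Linf \<Omega>.
        integrable (lebesgue :: ('a \<times> 'a) measure)
          (\<lambda>p. (u (fst p) - u (snd p)) * (v (fst p) - v (snd p)) * K (fst p) (snd p)) \<and>
        set_integrable lebesgue \<Omega> (\<lambda>x. a x * h (u x) * v x) \<and>
        set_integrable lebesgue \<Omega> (\<lambda>x. f x * v x) \<and>
        (1/2) * (\<integral>p. (u (fst p) - u (snd p)) * (v (fst p) - v (snd p)) * K (fst p) (snd p)
                   \<partial>(lebesgue :: ('a \<times> 'a) measure))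
          + (LINT x:\<Omega>|lebesgue. a x * h (u x) * v x)
        = (LINT x:\<Omega>|lebesgue. f x * v x))"

end

theory Submission
  imports Defs
begin

text \<open>
  The solution is found by the direct method, with \<open>k = h\<^sup>-\<^sup>1(Q)\<close> and \<open>H' = h\<close>. The functional
  \<open>J(u) = 1/4 \<integral>\<integral> (u(x) - u(z))\<^sup>2 K + \<integral> (a H(u) - f u)\<close> is minimised over the functions of
  \<open>H\<^sup>s\<^sub>0(\<Omega>)\<close> bounded by \<open>k\<close>. Its first part is quadratic and its second part convex, so the
  parallelogram law makes a minimising sequence Cauchy for the quadratic form, and a Poincare inequality,
  for which the kernel is only needed near the diagonal, turns this into a.e. convergence of the sequence;
  no compactness is used. Truncation at level \<open>k\<close> does not increase \<open>J\<close> because \<open>\<bar>f\<bar> \<le> a h(k)\<close>, so the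
  minimiser is a minimiser among all bounded functions of \<open>H\<^sup>s\<^sub>0(\<Omega>)\<close>, and its
  Euler-Lagrange equation is the weak equation. Testing the equation with the solution gives the energy
  bound; testing the difference of two equations with the difference of the solutions gives uniqueness.
\<close>

section \<open>Lebesgue measure on a product and a Poincare inequality\<close>

text \<open>The obstacle is that \<open>a\<close> and \<open>f\<close> are merely integrable, so the
  integral of \<open>a H(u) - f u\<close> is under control only for bounded \<open>u\<close>, and
  the functional cannot be treated directly on the whole energy space. The constraint |u| \<le> k
  repairs this, but a constrained minimiser satisfies a priori only a variational inequality. A
  second mismatch lies between the form and the space: the lower bound on the kernel controls pairs
  at distance below r, whereas membership in \<open>Hs s\<close> asks for a finite Gagliardo
  integral over all pairs. For bounded functions that vanish outside \<Omega> the remaining pairs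
  contribute a finite amount, because \<Omega> has finite measure and the kernel of order n + 2 s is
  integrable away from 0. This keeps the limit of a minimising sequence in the space.\<close>

text \<open>The measure \<open>lebesgue\<close> on pairs is the completion of a product, not a
  product of completions, so preimages of null sets have to be shown null. They are: a cylinder over
  a null set has measure 0 times infinity, which is 0 in \<open>ennreal\<close>.\<close>

lemma measurable_fst_lebesgue:
  "(fst :: 'a::euclidean_space \<times> 'b::euclidean_space \<Rightarrow> 'a) \<in> lebesgue \<rightarrow>\<^sub>M lebesgue"
proof (rule completion.measurable_completion2)
  show m: "(fst :: 'a \<times> 'b \<Rightarrow> 'a) \<in> lebesgue \<rightarrow>\<^sub>M lborel"
    by (rule measurable_completion) (simp add: borel_prod[symmetric])
  show "null_sets (lborel :: 'a measure) \<subseteq> null_sets (distr lebesgue lborel (fst :: 'a \<times> 'b \<Rightarrow> 'a))"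
  proof
    fix N :: "'a set" assume N: "N \<in> null_sets lborel"
    then have [measurable]: "N \<in> sets borel" by auto
    have "emeasure (distr lebesgue lborel (fst :: 'a \<times> 'b \<Rightarrow> 'a)) N
        = emeasure (lebesgue :: ('a \<times> 'b) measure) (N \<times> UNIV)"
      by (subst emeasure_distr[OF m]) (auto intro!: arg_cong[where f="emeasure _"])
    also have "\<dots> = emeasure (lborel :: ('a \<times> 'b) measure) (N \<times> UNIV)"
      by (simp add: borel_prod[symmetric])
    also have "\<dots> = 0"
      unfolding lborel_prod[symmetric] using N
      by (subst lborel.emeasure_pair_measure_Times) auto
    finally show "N \<in> null_sets (distr lebesgue lborel (fst :: 'a \<times> 'b \<Rightarrow> 'a))"
      by (auto simp: null_sets_def)
  qed
qed

lemma measurable_snd_lebesgue: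
  "(snd :: 'a::euclidean_space \<times> 'b::euclidean_space \<Rightarrow> 'b) \<in> lebesgue \<rightarrow>\<^sub>M lebesgue"
proof (rule completion.measurable_completion2)
  show m: "(snd :: 'a \<times> 'b \<Rightarrow> 'b) \<in> lebesgue \<rightarrow>\<^sub>M lborel"
    by (rule measurable_completion) (simp add: borel_prod[symmetric])
  show "null_sets (lborel :: 'b measure) \<subseteq> null_sets (distr lebesgue lborel (snd :: 'a \<times> 'b \<Rightarrow> 'b))"
  proof
    fix N :: "'b set" assume N: "N \<in> null_sets lborel"
    then have [measurable]: "N \<in> sets borel" by auto
    have "emeasure (distr lebesgue lborel (snd :: 'a \<times> 'b \<Rightarrow> 'b)) N
        = emeasure (lebesgue :: ('a \<times> 'b) measure) (UNIV \<times> N)"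
      by (subst emeasure_distr[OF m]) (auto intro!: arg_cong[where f="emeasure _"])
    also have "\<dots> = emeasure (lborel :: ('a \<times> 'b) measure) (UNIV \<times> N)"
      by (simp add: borel_prod[symmetric])
    also have "\<dots> = 0"
      unfolding lborel_prod[symmetric] using N
      by (subst lborel.emeasure_pair_measure_Times) auto
    finally show "N \<in> null_sets (distr lebesgue lborel (snd :: 'a \<times> 'b \<Rightarrow> 'b))"
      by (auto simp: null_sets_def)
  qed
qed

lemma AE_lebesgue_fst:
  assumes "AE x in (lebesgue :: 'a::euclidean_space measure). P x"
  shows "AE p in (lebesgue :: ('a \<times> 'b::euclidean_space) measure). P (fst p)"
proof -
  from assms have "AE x in (lborel :: 'a measure). P x"
    by (simp add: AE_completion_iff)
  then obtain N where N: "{x. \<not> P x} \<subseteq> N" "N \<in> null_sets (lborel :: 'a measure)"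
    by (auto elim!: AE_E simp: null_sets_def)
  then have [measurable]: "N \<in> sets borel" by auto
  have "N \<times> (UNIV :: 'b set) \<in> null_sets lborel"
    unfolding lborel_prod[symmetric] null_sets_def using N
    by (auto simp: lborel.emeasure_pair_measure_Times)
  moreover have "{p :: 'a \<times> 'b. \<not> P (fst p)} \<subseteq> N \<times> UNIV" using N by auto
  ultimately have "AE p in (lborel :: ('a \<times> 'b) measure). P (fst p)"
    by (auto intro: AE_I')
  then show ?thesis by (rule AE_completion)
qed

lemma AE_lebesgue_snd:
  assumes "AE x in (lebesgue :: 'b::euclidean_space measure). P x"
  shows "AE p in (lebesgue :: ('a::euclidean_space \<times> 'b) measure). P (snd p)"
proof -
  from assms have "AE x in (lborel :: 'b measure). P x"
    by (simp add: AE_completion_iff)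
  then obtain N where N: "{x. \<not> P x} \<subseteq> N" "N \<in> null_sets (lborel :: 'b measure)"
    by (auto elim!: AE_E simp: null_sets_def)
  then have [measurable]: "N \<in> sets borel" by auto
  have "(UNIV :: 'a set) \<times> N \<in> null_sets lborel"
    unfolding lborel_prod[symmetric] null_sets_def using N
    by (auto simp: lborel.emeasure_pair_measure_Times)
  moreover have "{p :: 'a \<times> 'b. \<not> P (snd p)} \<subseteq> UNIV \<times> N" using N by auto
  ultimately have "AE p in (lborel :: ('a \<times> 'b) measure). P (snd p)"
    by (auto intro: AE_I')
  then show ?thesis by (rule AE_completion)
qed

text \<open>Tonelli is applied on the Borel side only, where the measure on pairs is the product
  measure; Lebesgue measurable functions are replaced by Borel representatives beforehand.\<close>

lemma nn_integral_lborel_pair: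
  fixes F :: "'a::euclidean_space \<times> 'b::euclidean_space \<Rightarrow> ennreal"
  assumes "F \<in> borel_measurable borel"
  shows "(\<integral>\<^sup>+p. F p \<partial>lborel) = (\<integral>\<^sup>+x. (\<integral>\<^sup>+z. F (x, z) \<partial>lborel) \<partial>lborel)"
proof -
  have "F \<in> borel_measurable (lborel \<Otimes>\<^sub>M lborel)"
    using assms by (simp add: lborel_prod)
  from lborel.nn_integral_fst[OF this] show ?thesis by (simp add: lborel_prod)
qed

lemma nn_integral_lborel_pair':
  fixes F :: "'a::euclidean_space \<times> 'b::euclidean_space \<Rightarrow> ennreal"
  assumes "F \<in> borel_measurable borel"
  shows "(\<integral>\<^sup>+p. F p \<partial>lborel) = (\<integral>\<^sup>+z. (\<integral>\<^sup>+x. F (x, z) \<partial>lborel) \<partial>lborel)"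
proof -
  have "F \<in> borel_measurable (lborel \<Otimes>\<^sub>M lborel)"
    using assms by (simp add: lborel_prod)
  from lborel_pair.nn_integral_snd[OF this] show ?thesis by (simp add: lborel_prod)
qed

lemma nn_integral_lborel_shift:
  fixes F :: "'a::euclidean_space \<Rightarrow> ennreal"
  assumes [measurable]: "F \<in> borel_measurable borel"
  shows "(\<integral>\<^sup>+x. F (b + x) \<partial>lborel) = (\<integral>\<^sup>+x. F x \<partial>lborel)"
proof -
  have "(\<integral>\<^sup>+x. F x \<partial>lborel) = (\<integral>\<^sup>+x. F x \<partial>distr lborel borel ((+) b))"
    by (simp add: lborel_distr_plus)
  also have "\<dots> = (\<integral>\<^sup>+x. F (b + x) \<partial>lborel)"
    by (subst nn_integral_distr) auto
  finally show ?thesis by simp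
qed

text \<open>Dyadic shells take the place of polar coordinates: on 2^k r \<le> |y| < 2^(k+1) r the
  integrand is at most (2^k r)^(-p), the shell lies in a ball of volume proportional to (2^(k+1)
  r)^n, and the products form a geometric series of ratio 2^(n-p), which is below 1 because p
  exceeds the dimension n.\<close>

lemma nn_integral_powr_tail_finite:
  fixes p r :: real
  assumes p: "real DIM('a::euclidean_space) < p" and r: "0 < r"
  shows "(\<integral>\<^sup>+y. indicator {y. r \<le> norm y} y * ennreal (1 / norm y powr p) \<partial>(lborel :: 'a measure)) < \<infinity>"
proof -
  define \<omega> where "\<omega> = unit_ball_vol (real DIM('a))"
  have \<omega>: "0 \<le> \<omega>" by (simp add: \<omega>_def)
  define n where "n = real DIM('a)"
  define q where "q = 2 powr (n - p)"
  have q: "0 < q" "q < 1" using p by (auto simp: q_def n_def powr_less_one)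
  define t where "t k = 1 / (2 ^ k * r) powr p" for k :: nat
  have pw: "indicator {y. r \<le> norm y} y * ennreal (1 / norm y powr p)
      \<le> (\<Sum>k. ennreal (t k) * indicator (ball 0 (2 ^ Suc k * r)) y)" for y :: 'a
  proof (cases "r \<le> norm y")
    case True
    obtain m where m: "norm y / r < 2 ^ m" using real_arch_pow[of 2 "norm y / r"] by auto
    define l where "l = (LEAST m. norm y / r < 2 ^ m)"
    have l: "norm y / r < 2 ^ l" unfolding l_def by (rule LeastI) (rule m)
    \<comment> \<open>\<open>l\<close> is the first dyadic exponent above |y| / r. It is positive
      because r \<le> |y|, so it has a predecessor \<open>j\<close>, the index of the shell that
      contains y.\<close>
    have "l \<noteq> 0" using l True r by (intro notI) (simp add: field_simps)
    then obtain j where j: "l = Suc j" by (cases l) auto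
    have "\<not> norm y / r < 2 ^ j" using not_less_Least[of j] j unfolding l_def[symmetric]
      by (metis l_def lessI not_less_Least)
    then have low: "2 ^ j * r \<le> norm y" using r by (simp add: field_simps)
    have y0: "0 < norm y" using True r by linarith
    have up: "norm y < 2 ^ Suc j * r" using l j r by (simp add: field_simps)
    have "ennreal (1 / norm y powr p) \<le> ennreal (t j)"
      unfolding t_def using low r p y0
      by (intro ennreal_leI divide_left_mono powr_mono2 mult_pos_pos) (auto)
    also have "\<dots> = (\<Sum>k\<in>{j}. ennreal (t k) * indicator (ball 0 (2 ^ Suc k * r)) y)"
      using up by (simp add: indicator_def)
    also have "\<dots> \<le> (\<Sum>k. ennreal (t k) * indicator (ball 0 (2 ^ Suc k * r)) y)"
      by (rule sum_le_suminf) auto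
    finally show ?thesis using True by simp
  qed simp
  have "(\<integral>\<^sup>+y. indicator {y. r \<le> norm y} y * ennreal (1 / norm y powr p) \<partial>(lborel :: 'a measure))
     \<le> (\<integral>\<^sup>+y. (\<Sum>k. ennreal (t k) * indicator (ball 0 (2 ^ Suc k * r)) y) \<partial>(lborel :: 'a measure))"
    by (intro nn_integral_mono pw)
  also have "\<dots> = (\<Sum>k. \<integral>\<^sup>+y. ennreal (t k) * indicator (ball 0 (2 ^ Suc k * r)) y \<partial>(lborel :: 'a measure))"
  proof (rule nn_integral_suminf)
    fix k
    have "ball (0 :: 'a) (2 ^ Suc k * r) \<in> sets lborel" by simp
    then show "(\<lambda>y :: 'a. ennreal (t k) * indicator (ball 0 (2 ^ Suc k * r)) y) \<in> borel_measurable lborel"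
      by (intro borel_measurable_times_ennreal borel_measurable_const borel_measurable_indicator)
  qed
  also have "\<dots> = (\<Sum>k. ennreal (\<omega> * 2 ^ DIM('a) * r powr (n - p) * q ^ k))"
  proof (rule suminf_cong)
    fix k
    have "(\<integral>\<^sup>+y. ennreal (t k) * indicator (ball 0 (2 ^ Suc k * r)) y \<partial>(lborel :: 'a measure))
      = ennreal (t k) * ennreal (\<omega> * (2 ^ Suc k * r) ^ DIM('a))"
      using r by (subst nn_integral_cmult_indicator) (simp_all add: emeasure_ball \<omega>_def)
    also have "\<dots> = ennreal (t k * (\<omega> * (2 ^ Suc k * r) ^ DIM('a)))"
      using r by (subst ennreal_mult[symmetric]) (simp_all add: t_def \<omega>)
    also have "t k * (\<omega> * (2 ^ Suc k * r) ^ DIM('a)) = \<omega> * 2 ^ DIM('a) * r powr (n - p) * q ^ k"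
    proof -
      have a: "(2 ^ k * r) ^ DIM('a) = (2 ^ k * r) powr n"
        using r by (simp add: n_def powr_realpow)
      have b: "(2 ^ k * r) powr n / (2 ^ k * r) powr p = (2 ^ k * r) powr (n - p)"
        by (simp add: powr_diff)
      have c: "(2 ^ k :: real) powr (n - p) = q ^ k"
        unfolding q_def by (simp add: powr_realpow[symmetric] powr_powr mult.commute)
      have d: "(2 ^ k * r) powr (n - p) = q ^ k * r powr (n - p)"
        using r by (subst powr_mult) (simp_all add: c)
      have "t k * (\<omega> * (2 ^ Suc k * r) ^ DIM('a)) = \<omega> * 2 ^ DIM('a) * ((2 ^ k * r) ^ DIM('a) / (2 ^ k * r) powr p)"
        by (simp add: t_def power_mult_distrib)
      also have "\<dots> = \<omega> * 2 ^ DIM('a) * (q ^ k * r powr (n - p))"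
        unfolding a b d ..
      finally show ?thesis by (simp only: mult_ac)
    qed
    finally show "(\<integral>\<^sup>+y. ennreal (t k) * indicator (ball 0 (2 ^ Suc k * r)) y \<partial>(lborel :: 'a measure))
       = ennreal (\<omega> * 2 ^ DIM('a) * r powr (n - p) * q ^ k)" .
  qed
  also have "\<dots> < \<infinity>"
    using q \<omega> by (subst suminf_ennreal2) (auto intro!: summable_mult summable_geometric)
  finally show ?thesis .
qed

text \<open>If \<open>N y\<close> is longer than the diameter of the support of \<open>w\<close>, then \<open>w\<close> is the sum of \<open>N\<close>
  translates of the increment \<open>w - w (\<cdot> + y)\<close> on its support.\<close>

lemma nn_integral_square_le_increments:
  fixes w :: "'a::euclidean_space \<Rightarrow> real"
  assumes [measurable]: "w \<in> borel_measurable borel"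
    and w0: "\<And>x. R \<le> norm x \<Longrightarrow> w x = 0" and y: "2 * R \<le> real N * norm y"
  shows "(\<integral>\<^sup>+x. ennreal ((w x)\<^sup>2) \<partial>lborel)
       \<le> ennreal ((real N)\<^sup>2) * (\<integral>\<^sup>+x. ennreal ((w x - w (x + y))\<^sup>2) \<partial>lborel)"
proof -
  define d where "d x = w x - w (x + y)" for x
  have [measurable]: "d \<in> borel_measurable borel" unfolding d_def by measurable
  \<comment> \<open>Cauchy-Schwarz for the telescoping sum costs one factor \<open>N\<close>; the
    second factor in \<open>N\<close> squared appears after integration, when the \<open>N\<close>
    translated increments all have the same integral.\<close>
  have pw: "(w x)\<^sup>2 \<le> real N * (\<Sum>j<N. (d (real j *\<^sub>R y + x))\<^sup>2)" for x
  proof (cases "norm x < R")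
    case True
    have "real N * norm y - norm x \<le> norm (x + real N *\<^sub>R y)"
      using norm_diff_ineq[of "real N *\<^sub>R y" x] by (simp add: add.commute)
    then have "w (real N *\<^sub>R y + x) = 0" using True y by (intro w0) (simp add: add.commute)
    moreover have "(\<Sum>j<N. d (real j *\<^sub>R y + x)) = w x - w (real N *\<^sub>R y + x)"
    proof -
      have "(\<Sum>j<N. d (real j *\<^sub>R y + x)) = (\<Sum>j<N. w (real j *\<^sub>R y + x) - w (real (Suc j) *\<^sub>R y + x))"
        by (intro sum.cong) (auto simp: d_def algebra_simps)
      also have "\<dots> = w x - w (real N *\<^sub>R y + x)"
        by (subst sum_lessThan_telescope'[where f="\<lambda>j. w (real j *\<^sub>R y + x)"]) simp
      finally show ?thesis .
    qed
    ultimately have "(w x)\<^sup>2 = (\<Sum>j<N. d (real j *\<^sub>R y + x))\<^sup>2" by simp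
    also have "\<dots> \<le> (\<Sum>j<N. (d (real j *\<^sub>R y + x))\<^sup>2) * real (card {..<N})"
      by (rule sum_squared_le_sum_of_squares)
    finally show ?thesis by (simp add: mult.commute)
  qed (auto simp: w0 intro!: mult_nonneg_nonneg sum_nonneg)
  have "(\<integral>\<^sup>+x. ennreal ((w x)\<^sup>2) \<partial>lborel)
     \<le> (\<integral>\<^sup>+x. ennreal (real N) * (\<Sum>j<N. ennreal ((d (real j *\<^sub>R y + x))\<^sup>2)) \<partial>lborel)"
    using pw by (intro nn_integral_mono) (simp add: ennreal_mult[symmetric] sum_nonneg ennreal_leI)
  also have "\<dots> = ennreal (real N) * (\<Sum>j<N. \<integral>\<^sup>+x. ennreal ((d (real j *\<^sub>R y + x))\<^sup>2) \<partial>lborel)"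
    by (subst nn_integral_cmult) (simp_all add: nn_integral_sum del: sum_ennreal)
  also have "\<dots> = ennreal (real N) * (\<Sum>j<N. \<integral>\<^sup>+x. ennreal ((d x)\<^sup>2) \<partial>lborel)"
    by (subst nn_integral_lborel_shift[where F="\<lambda>x. ennreal ((d x)\<^sup>2)"]) simp_all
  also have "\<dots> = ennreal ((real N)\<^sup>2) * (\<integral>\<^sup>+x. ennreal ((d x)\<^sup>2) \<partial>lborel)"
    by (simp add: power2_eq_square ennreal_mult mult.assoc ennreal_of_nat_eq_real_of_nat)
  finally show ?thesis by (simp add: d_def)
qed

text \<open>The increment estimate holds for every single direction y with r/2 < |y| < r. Averaging
  it over a ball \<open>A\<close> of such directions produces a double integral over x and y, and
  the substitution z = x + y turns it into an integral over pairs at distance below r. The constant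
  is N^2 divided by the volume of \<open>A\<close>.\<close>

lemma poincare_borel:
  fixes R r :: real
  assumes r: "0 < r"
  obtains P :: real where "0 < P"
    "\<And>w :: 'a::euclidean_space \<Rightarrow> real. w \<in> borel_measurable borel \<Longrightarrow> (\<And>x. R \<le> norm x \<Longrightarrow> w x = 0) \<Longrightarrow>
      (\<integral>\<^sup>+x. ennreal ((w x)\<^sup>2) \<partial>lborel) \<le> ennreal P *
      (\<integral>\<^sup>+p. ennreal ((w (fst p) - w (snd p))\<^sup>2) * indicator {p. norm (fst p - snd p) < r} p \<partial>lborel)"
proof -
  \<comment> \<open>All directions used below are longer than r/2, so N \<ge> 4 R / r gives N |y|
    \<ge> 2 R. Positivity of \<open>N\<close> makes the final constant positive.\<close>
  obtain N :: nat where N: "4 * R / r \<le> real N" "0 < N"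
  proof -
    obtain N :: nat where "4 * R / r \<le> real N" using real_arch_simple by blast
    then show ?thesis using that[of "Suc N"] by simp
  qed
  obtain e :: 'a where e: "norm e = 1" using vector_choose_size[of 1] by auto
  \<comment> \<open>A ball centred midway between the radii r/2 and r, with radius half their
    difference, fits into the annulus.\<close>
  define y0 where "y0 = (3 * r / 4) *\<^sub>R e"
  define A where "A = ball y0 (r / 4)"
  have A: "r / 2 < norm y" "norm y < r" if "y \<in> A" for y
  proof -
    have "norm (y - y0) < r / 4" using that by (simp add: A_def dist_norm norm_minus_commute)
    moreover have "norm y0 = 3 * r / 4" using r e by (simp add: y0_def)
    ultimately show "r / 2 < norm y" "norm y < r"
      using norm_triangle_ineq2[of y y0] norm_triangle_ineq3[of y y0] by linarith+
  qed
  define \<alpha> where "\<alpha> = measure lborel A"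
  have \<alpha>: "0 < \<alpha>" using r by (simp add: \<alpha>_def A_def)
  have eA: "emeasure lborel A = ennreal \<alpha>"
    unfolding \<alpha>_def A_def by (intro emeasure_eq_ennreal_measure) (use emeasure_lborel_ball_finite in \<open>auto simp: less_top\<close>)
  show ?thesis
  proof (rule that)
    show "0 < (real N)\<^sup>2 / \<alpha>" using N \<alpha> by simp
    fix w :: "'a \<Rightarrow> real"
    assume [measurable]: "w \<in> borel_measurable borel" and w0: "\<And>x. R \<le> norm x \<Longrightarrow> w x = 0"
    define I where "I = (\<integral>\<^sup>+x. ennreal ((w x)\<^sup>2) \<partial>lborel)"
    define G where "G = (\<lambda>p :: 'a \<times> 'a. ennreal ((w (fst p) - w (snd p))\<^sup>2) * indicator {p. norm (fst p - snd p) < r} p)"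
    have [measurable]: "G \<in> borel_measurable borel"
      unfolding G_def by (simp add: borel_prod[symmetric])
    have [measurable]: "A \<in> sets borel" by (simp add: A_def)
    have "ennreal \<alpha> * I = (\<integral>\<^sup>+y. I * indicator A y \<partial>lborel)"
      by (subst nn_integral_cmult_indicator) (simp_all add: eA mult.commute)
    also have "\<dots> \<le> (\<integral>\<^sup>+y. ennreal ((real N)\<^sup>2) * (\<integral>\<^sup>+x. G (x, x + y) \<partial>lborel) \<partial>lborel)"
    proof (rule nn_integral_mono)
      fix y :: 'a
      show "I * indicator A y \<le> ennreal ((real N)\<^sup>2) * (\<integral>\<^sup>+x. G (x, x + y) \<partial>lborel)"
      proof (cases "y \<in> A")
        case True
        have "4 * R \<le> real N * r" using N r by (simp add: field_simps)
        also have "\<dots> \<le> real N * (2 * norm y)" using A[OF True] by (intro mult_left_mono) auto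
        finally have "I \<le> ennreal ((real N)\<^sup>2) * (\<integral>\<^sup>+x. ennreal ((w x - w (x + y))\<^sup>2) \<partial>lborel)"
          unfolding I_def by (intro nn_integral_square_le_increments[where R=R] w0) auto
        also have "(\<lambda>x. ennreal ((w x - w (x + y))\<^sup>2)) = (\<lambda>x. G (x, x + y))"
          using A[OF True] by (auto simp: G_def)
        finally show ?thesis using True by simp
      qed simp
    qed
    also have "\<dots> = ennreal ((real N)\<^sup>2) * (\<integral>\<^sup>+y. (\<integral>\<^sup>+x. G (x, x + y) \<partial>lborel) \<partial>lborel)"
    proof (rule nn_integral_cmult)
      have "(\<lambda>(y, x). G (x, x + y)) \<in> borel_measurable (borel \<Otimes>\<^sub>M (borel :: 'a measure))"
        unfolding borel_prod split_beta'
        by (rule measurable_compose[OF _ \<open>G \<in> _\<close>])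
          (auto intro!: borel_measurable_continuous_onI continuous_intros)
      then show "(\<lambda>y. \<integral>\<^sup>+x. G (x, x + y) \<partial>lborel) \<in> borel_measurable lborel"
        by (intro lborel.borel_measurable_nn_integral) (simp add: lborel_prod borel_prod)
    qed
    \<comment> \<open>With x as the outer variable the shift x is fixed in the inner integral, and
      translation invariance removes it.\<close>
    also have "(\<integral>\<^sup>+y. (\<integral>\<^sup>+x. G (x, x + y) \<partial>lborel) \<partial>lborel) = (\<integral>\<^sup>+x. (\<integral>\<^sup>+y. G (x, x + y) \<partial>lborel) \<partial>lborel)"
    proof -
      have m: "(\<lambda>q. G (fst q, fst q + snd q)) \<in> borel_measurable borel"
        by (rule measurable_compose[OF _ \<open>G \<in> _\<close>])
          (auto intro!: borel_measurable_continuous_onI continuous_intros)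
      show ?thesis
        using nn_integral_lborel_pair[OF m] nn_integral_lborel_pair'[OF m] by simp
    qed
    also have "\<dots> = (\<integral>\<^sup>+x. (\<integral>\<^sup>+z. G (x, z) \<partial>lborel) \<partial>lborel)"
    proof (rule nn_integral_cong)
      fix x :: 'a
      have "(\<lambda>z. G (x, z)) \<in> borel_measurable borel"
        by (rule measurable_compose[OF _ \<open>G \<in> _\<close>])
          (auto intro!: borel_measurable_continuous_onI continuous_intros)
      from nn_integral_lborel_shift[OF this, of x]
      show "(\<integral>\<^sup>+y. G (x, x + y) \<partial>lborel) = (\<integral>\<^sup>+z. G (x, z) \<partial>lborel)" .
    qed
    also have "\<dots> = (\<integral>\<^sup>+p. G p \<partial>lborel)" by (rule nn_integral_lborel_pair[symmetric]) simp
    finally have *: "ennreal \<alpha> * I \<le> ennreal ((real N)\<^sup>2) * (\<integral>\<^sup>+p. G p \<partial>lborel)" .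
    have "I = ennreal (1 / \<alpha>) * (ennreal \<alpha> * I)"
      using \<alpha> by (simp add: mult.assoc[symmetric] ennreal_mult[symmetric])
    also have "\<dots> \<le> ennreal (1 / \<alpha>) * (ennreal ((real N)\<^sup>2) * (\<integral>\<^sup>+p. G p \<partial>lborel))"
      by (rule mult_left_mono[OF *]) simp
    also have "\<dots> = ennreal ((real N)\<^sup>2 / \<alpha>) * (\<integral>\<^sup>+p. G p \<partial>lborel)"
      using \<alpha> by (simp add: mult.assoc[symmetric] ennreal_mult[symmetric])
    finally show "(\<integral>\<^sup>+x. ennreal ((w x)\<^sup>2) \<partial>lborel) \<le> ennreal ((real N)\<^sup>2 / \<alpha>) *
      (\<integral>\<^sup>+p. ennreal ((w (fst p) - w (snd p))\<^sup>2) * indicator {p. norm (fst p - snd p) < r} p \<partial>lborel)"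
      by (simp add: I_def G_def)
  qed
qed

lemma poincare_lebesgue:
  fixes R r :: real
  assumes r: "0 < r"
  obtains P :: real where "0 < P"
    "\<And>w :: 'a::euclidean_space \<Rightarrow> real. w \<in> borel_measurable lebesgue \<Longrightarrow>
      (AE x in lebesgue. R \<le> norm x \<longrightarrow> w x = 0) \<Longrightarrow>
      (\<integral>\<^sup>+x. ennreal ((w x)\<^sup>2) \<partial>lebesgue) \<le> ennreal P *
      (\<integral>\<^sup>+p. ennreal ((w (fst p) - w (snd p))\<^sup>2) * indicator {p. norm (fst p - snd p) < r} p \<partial>lebesgue)"
proof -
  obtain P where P: "0 < P" "\<And>w :: 'a \<Rightarrow> real. w \<in> borel_measurable borel \<Longrightarrow> (\<And>x. R \<le> norm x \<Longrightarrow> w x = 0) \<Longrightarrow>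
      (\<integral>\<^sup>+x. ennreal ((w x)\<^sup>2) \<partial>lborel) \<le> ennreal P *
      (\<integral>\<^sup>+p. ennreal ((w (fst p) - w (snd p))\<^sup>2) * indicator {p. norm (fst p - snd p) < r} p \<partial>lborel)"
    using poincare_borel[OF r] by blast
  show ?thesis
  proof (rule that[OF P(1)])
    fix w :: "'a \<Rightarrow> real"
    assume w: "w \<in> borel_measurable lebesgue" and w0: "AE x in lebesgue. R \<le> norm x \<longrightarrow> w x = 0"
    obtain g where g[measurable]: "g \<in> borel_measurable lborel" and wg: "AE x in lborel. w x = g x"
      using completion_ex_borel_measurable_real[OF w] by auto
    \<comment> \<open>The increment estimate needs vanishing outside the ball at every point, not
      just almost everywhere. The cutoff enforces this and changes \<open>g\<close> on a null set
      only.\<close>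
    define v where "v x = g x * indicator (ball 0 R) x" for x
    have [measurable]: "v \<in> borel_measurable borel" unfolding v_def
      by (rule borel_measurable_times, use g in simp, rule borel_measurable_indicator) simp
    have wv: "AE x in lebesgue. w x = v x"
      using w0 AE_completion[OF wg] by eventually_elim (auto simp: v_def indicator_def)
    have "(\<integral>\<^sup>+x. ennreal ((w x)\<^sup>2) \<partial>lebesgue) = (\<integral>\<^sup>+x. ennreal ((v x)\<^sup>2) \<partial>lborel)"
      using wv by (subst nn_integral_completion[symmetric]) (auto intro!: nn_integral_cong_AE)
    also have "\<dots> \<le> ennreal P *
      (\<integral>\<^sup>+p. ennreal ((v (fst p) - v (snd p))\<^sup>2) * indicator {p. norm (fst p - snd p) < r} p \<partial>lborel)"
      by (rule P(2)) (simp, simp add: v_def)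
    also have "(\<integral>\<^sup>+p. ennreal ((v (fst p) - v (snd p))\<^sup>2) * indicator {p. norm (fst p - snd p) < r} p \<partial>lborel)
      = (\<integral>\<^sup>+p. ennreal ((w (fst p) - w (snd p))\<^sup>2) * indicator {p. norm (fst p - snd p) < r} p \<partial>lebesgue)"
      unfolding nn_integral_completion[symmetric, of lborel]
      using AE_lebesgue_fst[OF wv] AE_lebesgue_snd[OF wv]
      by (intro nn_integral_cong_AE, eventually_elim) simp
    finally show "(\<integral>\<^sup>+x. ennreal ((w x)\<^sup>2) \<partial>lebesgue) \<le> ennreal P *
      (\<integral>\<^sup>+p. ennreal ((w (fst p) - w (snd p))\<^sup>2) * indicator {p. norm (fst p - snd p) < r} p \<partial>lebesgue)" .
  qed
qed

text \<open>With one point held fixed in \<open>S\<close>, integrating over the other gives the tail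
  integral of |y|^(-q), whatever the fixed point is; each of the two summands is therefore the
  measure of \<open>S\<close> times that tail.\<close>

lemma nn_integral_far_finite:
  fixes S :: "'a::euclidean_space set" and q r :: real
  assumes q: "real DIM('a) < q" and r: "0 < r"
    and S: "S \<in> sets borel" "emeasure lborel S < \<infinity>"
  shows "(\<integral>\<^sup>+p. (indicator S (fst p) + indicator S (snd p)) * (indicator {p. r \<le> norm (fst p - snd p)} p
      * ennreal (1 / norm (fst p - snd p) powr q)) \<partial>(lebesgue :: ('a \<times> 'a) measure)) < \<infinity>"
proof -
  define T where "T = (\<lambda>y :: 'a. indicator {y. r \<le> norm y} y * ennreal (1 / norm y powr q))"
  have [measurable]: "T \<in> borel_measurable borel" unfolding T_def by measurable
  have [measurable]: "S \<in> sets borel" by fact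
  have Tfin: "(\<integral>\<^sup>+y. T y \<partial>lborel) < \<infinity>"
    unfolding T_def by (rule nn_integral_powr_tail_finite[OF q r])
  have Tneg: "T (- y) = T y" for y by (simp add: T_def indicator_def)
  have m1: "(\<lambda>p. indicator S (fst p) * T (fst p - snd p)) \<in> borel_measurable borel"
    by (simp add: borel_prod[symmetric])
  have m2: "(\<lambda>p. indicator S (snd p) * T (fst p - snd p)) \<in> borel_measurable borel"
    by (simp add: borel_prod[symmetric])
  have 1: "(\<integral>\<^sup>+z. T (x - z) \<partial>lborel) = (\<integral>\<^sup>+y. T y \<partial>lborel)" for x
  proof -
    have "(\<integral>\<^sup>+z. T (x - z) \<partial>lborel) = (\<integral>\<^sup>+z. T (- x + z) \<partial>lborel)"
      by (intro nn_integral_cong) (metis Tneg minus_diff_eq uminus_add_conv_diff)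
    also have "\<dots> = (\<integral>\<^sup>+y. T y \<partial>lborel)" by (rule nn_integral_lborel_shift) simp
    finally show ?thesis .
  qed
  have 2: "(\<integral>\<^sup>+x. T (x - z) \<partial>lborel) = (\<integral>\<^sup>+y. T y \<partial>lborel)" for z
    using nn_integral_lborel_shift[of T "- z"] by simp
  have "(\<integral>\<^sup>+p. (indicator S (fst p) + indicator S (snd p)) * T (fst p - snd p) \<partial>(lebesgue :: ('a \<times> 'a) measure))
    = (\<integral>\<^sup>+p. indicator S (fst p) * T (fst p - snd p) + indicator S (snd p) * T (fst p - snd p) \<partial>lborel)"
    by (simp add: nn_integral_completion distrib_right)
  also have "\<dots> = (\<integral>\<^sup>+p. indicator S (fst p) * T (fst p - snd p) \<partial>lborel)
      + (\<integral>\<^sup>+p. indicator S (snd p) * T (fst p - snd p) \<partial>lborel)"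
    by (rule nn_integral_add) (use m1 m2 in simp_all)
  also have "(\<integral>\<^sup>+p. indicator S (fst p) * T (fst p - snd p) \<partial>lborel) = emeasure lborel S * (\<integral>\<^sup>+y. T y \<partial>lborel)"
    by (simp add: nn_integral_lborel_pair[OF m1] nn_integral_cmult 1 nn_integral_multc)
  also have "(\<integral>\<^sup>+p. indicator S (snd p) * T (fst p - snd p) \<partial>lborel) = emeasure lborel S * (\<integral>\<^sup>+y. T y \<partial>lborel)"
    by (simp add: nn_integral_lborel_pair'[OF m2] nn_integral_cmult 2 nn_integral_multc)
  also have "emeasure lborel S * (\<integral>\<^sup>+y. T y \<partial>lborel) + emeasure lborel S * (\<integral>\<^sup>+y. T y \<partial>lborel) < \<infinity>"
    using Tfin S by (simp add: ennreal_mult_less_top)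
  finally show ?thesis by (simp add: T_def indicator_def)
qed

section \<open>The quadratic form\<close>

definition incr :: "('a \<Rightarrow> real) \<Rightarrow> 'a \<times> 'a \<Rightarrow> real" where
  "incr u p = u (fst p) - u (snd p)"

lemma measurable_incr [measurable]:
  fixes u :: "'a::euclidean_space \<Rightarrow> real"
  assumes "u \<in> borel_measurable lebesgue"
  shows "incr u \<in> borel_measurable lebesgue"
  unfolding incr_def
  using measurable_compose[OF measurable_fst_lebesgue assms]
    measurable_compose[OF measurable_snd_lebesgue assms]
  by (rule borel_measurable_diff)

lemma measurable_norm_diff [measurable]:
  "(\<lambda>p. norm (fst p - snd p)) \<in> borel_measurable (lebesgue :: ('a::euclidean_space \<times> 'a) measure)"
  by (rule measurable_completion) (simp add: borel_prod[symmetric])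

text \<open>The denominator of the Gagliardo integrand. On the diagonal it is 0, and division by 0
  gives 0, so quotients by it vanish there.\<close>

definition weight :: "real \<Rightarrow> 'a::euclidean_space \<times> 'a \<Rightarrow> real" where
  "weight s p = norm (fst p - snd p) powr (real DIM('a) + 2 * s)"

lemma weight_nonneg [simp]: "0 \<le> weight s p"
  by (simp add: weight_def)

lemma measurable_weight [measurable]: "weight s \<in> borel_measurable lebesgue"
  unfolding weight_def by measurable

lemma Hs_iff:
  fixes u :: "'a::euclidean_space \<Rightarrow> real"
  shows "u \<in> Hs s \<longleftrightarrow> u \<in> borel_measurable lebesgue \<and> integrable lebesgue (\<lambda>x. (u x)\<^sup>2) \<and>
     integrable lebesgue (\<lambda>p. (incr u p)\<^sup>2 / weight s p)"
proof -
  have "(\<integral>\<^sup>+p. ennreal ((incr u p)\<^sup>2 / weight s p) \<partial>lebesgue) < \<infinity> \<longleftrightarrow>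
      integrable lebesgue (\<lambda>p. (incr u p)\<^sup>2 / weight s p)" if [measurable]: "u \<in> borel_measurable lebesgue"
    by (simp add: integrable_iff_bounded)
  then show ?thesis by (auto simp: Hs_def incr_def weight_def)
qed

section \<open>Linear combinations and contractions in the fractional Sobolev space\<close>

lemma Hs_measurable: "u \<in> Hs s \<Longrightarrow> u \<in> borel_measurable lebesgue"
  by (simp add: Hs_def)

lemma Hs_zero: "(\<lambda>x. 0) \<in> Hs s"
  by (simp add: Hs_iff incr_def)

lemma Hs_lincomb:
  assumes u: "u \<in> Hs s" and v: "v \<in> Hs s"
  shows "(\<lambda>x. \<alpha> * u x + \<beta> * v x) \<in> Hs s"
proof -
  have [measurable]: "u \<in> borel_measurable lebesgue" "v \<in> borel_measurable lebesgue"
    using u v by (auto simp: Hs_iff)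
  have sq: "(\<alpha> * x + \<beta> * y)\<^sup>2 \<le> 2 * \<alpha>\<^sup>2 * x\<^sup>2 + 2 * \<beta>\<^sup>2 * y\<^sup>2" for x y :: real
    using zero_le_power2[of "\<alpha> * x - \<beta> * y"] by (simp add: power2_eq_square algebra_simps)
  have [measurable]: "(\<lambda>x. \<alpha> * u x + \<beta> * v x) \<in> borel_measurable lebesgue" by measurable
  have "integrable lebesgue (\<lambda>x. 2 * \<alpha>\<^sup>2 * (u x)\<^sup>2 + 2 * \<beta>\<^sup>2 * (v x)\<^sup>2)"
    using u v by (auto simp: Hs_iff)
  then have 1: "integrable lebesgue (\<lambda>x. (\<alpha> * u x + \<beta> * v x)\<^sup>2)"
    by (rule Bochner_Integration.integrable_bound) (auto intro!: AE_I2 order_trans[OF sq])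
  have "integrable lebesgue (\<lambda>p. 2 * \<alpha>\<^sup>2 * ((incr u p)\<^sup>2 / weight s p) + 2 * \<beta>\<^sup>2 * ((incr v p)\<^sup>2 / weight s p))"
    using u v by (intro Bochner_Integration.integrable_add integrable_mult_right) (auto simp: Hs_iff)
  then have 2: "integrable lebesgue (\<lambda>p. (incr (\<lambda>x. \<alpha> * u x + \<beta> * v x) p)\<^sup>2 / weight s p)"
  proof (rule Bochner_Integration.integrable_bound, measurable, intro AE_I2)
    fix p :: "'a \<times> 'a"
    have "incr (\<lambda>x. \<alpha> * u x + \<beta> * v x) p = \<alpha> * incr u p + \<beta> * incr v p"
      by (simp add: incr_def algebra_simps)
    then have "(incr (\<lambda>x. \<alpha> * u x + \<beta> * v x) p)\<^sup>2 / weight s p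
        \<le> (2 * \<alpha>\<^sup>2 * (incr u p)\<^sup>2 + 2 * \<beta>\<^sup>2 * (incr v p)\<^sup>2) / weight s p"
      by (intro divide_right_mono) (use sq in auto)
    then show "norm ((incr (\<lambda>x. \<alpha> * u x + \<beta> * v x) p)\<^sup>2 / weight s p)
      \<le> norm (2 * \<alpha>\<^sup>2 * ((incr u p)\<^sup>2 / weight s p) + 2 * \<beta>\<^sup>2 * ((incr v p)\<^sup>2 / weight s p))"
      by (simp add: add_divide_distrib)
  qed
  show ?thesis using 1 2 by (simp add: Hs_iff)
qed

text \<open>A 1-Lipschitz map that fixes 0 enlarges neither |u| nor any increment of u, so both
  defining integrals decrease. It will be applied to truncation.\<close>

lemma Hs_contraction:
  assumes u: "u \<in> Hs s" and T: "\<And>x y :: real. \<bar>T x - T y\<bar> \<le> \<bar>x - y\<bar>" "T 0 = 0"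
  shows "(\<lambda>x. T (u x)) \<in> Hs s"
proof -
  have [measurable]: "u \<in> borel_measurable lebesgue"
    using u by (auto simp: Hs_iff)
  have "continuous_on UNIV T"
    by (rule lipschitz_on_continuous_on[of 1]) (auto intro!: lipschitz_onI simp: dist_real_def T)
  then have [measurable]: "T \<in> borel_measurable borel"
    by (rule borel_measurable_continuous_onI)
  have [measurable]: "(\<lambda>x. T (u x)) \<in> borel_measurable lebesgue" by measurable
  have 0: "\<bar>T x\<bar> \<le> \<bar>x\<bar>" for x using T(1)[of x 0] T(2) by simp
  have "integrable lebesgue (\<lambda>x. (u x)\<^sup>2)" using u by (simp add: Hs_iff)
  then have 1: "integrable lebesgue (\<lambda>x. (T (u x))\<^sup>2)"
    by (rule Bochner_Integration.integrable_bound) (auto intro!: AE_I2 simp: abs_le_square_iff[symmetric] 0)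
  have "integrable lebesgue (\<lambda>p. (incr u p)\<^sup>2 / weight s p)" using u by (simp add: Hs_iff)
  then have 2: "integrable lebesgue (\<lambda>p. (incr (\<lambda>x. T (u x)) p)\<^sup>2 / weight s p)"
  proof (rule Bochner_Integration.integrable_bound, measurable, intro AE_I2)
    fix p :: "'a \<times> 'a"
    have "(incr (\<lambda>x. T (u x)) p)\<^sup>2 \<le> (incr u p)\<^sup>2"
      using T(1) by (simp add: incr_def abs_le_square_iff[symmetric])
    then show "norm ((incr (\<lambda>x. T (u x)) p)\<^sup>2 / weight s p) \<le> norm ((incr u p)\<^sup>2 / weight s p)"
      by (simp add: divide_right_mono)
  qed
  show ?thesis using 1 2 by (simp add: Hs_iff)
qed

lemma Hs0_lincomb:
  assumes "u \<in> Hs0 s \<Omega>" "v \<in> Hs0 s \<Omega>"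
  shows "(\<lambda>x. \<alpha> * u x + \<beta> * v x) \<in> Hs0 s \<Omega>"
  using assms by (auto simp: Hs0_def Hs_lincomb elim: eventually_elim2)

lemma Hs0_contraction:
  assumes "u \<in> Hs0 s \<Omega>" and T: "\<And>x y :: real. \<bar>T x - T y\<bar> \<le> \<bar>x - y\<bar>" "T 0 = 0"
  shows "(\<lambda>x. T (u x)) \<in> Hs0 s \<Omega>"
  using assms by (auto simp: Hs0_def Hs_contraction elim!: eventually_mono)

lemma Hs0_Linf_bounded:
  assumes "u \<in> Hs0 s \<Omega>" "u \<in> Linf \<Omega>"
  obtains B where "AE x in lebesgue. \<bar>u x\<bar> \<le> B"
proof -
  obtain B where "AE x in lebesgue. x \<in> \<Omega> \<longrightarrow> \<bar>u x\<bar> \<le> B" using assms by (auto simp: Linf_def)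
  moreover have "AE x in lebesgue. x \<notin> \<Omega> \<longrightarrow> u x = 0" using assms by (auto simp: Hs0_def)
  \<comment> \<open>The maximum with 0 is for the points outside \<Omega>: the bound
    \<open>B\<close> on \<Omega> may be negative if \<Omega> is a null set.\<close>
  ultimately have "AE x in lebesgue. \<bar>u x\<bar> \<le> max B 0" by eventually_elim auto
  then show ?thesis by (rule that)
qed

lemma LinfI:
  assumes "u \<in> Hs0 s \<Omega>" "AE x in lebesgue. \<bar>u x\<bar> \<le> B"
  shows "u \<in> Linf \<Omega>"
  using assms by (auto simp: Linf_def Hs0_def Hs_def elim: eventually_mono)

text \<open>Here \<open>r\<close> is a real number below the possibly infinite range of the lower
  bound. The kernel bounds are required off the diagonal, where the quotients have their usual
  meaning; on the diagonal all increments vanish.\<close>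

locale nonlocal_form =
  fixes \<Omega> :: "'a::euclidean_space set" and K :: "'a \<Rightarrow> 'a \<Rightarrow> real" and s c C r :: real
  assumes s_pos: "0 < s" and \<Omega>_open: "open \<Omega>" and \<Omega>_bounded: "bounded \<Omega>"
    and K_measurable: "(\<lambda>p. K (fst p) (snd p)) \<in> borel_measurable (lebesgue :: ('a \<times> 'a) measure)"
    and c_pos: "0 < c" and C_pos: "0 < C" and r_pos: "0 < r"
    and K_nonneg: "0 \<le> K x z"
    and K_lower: "\<lbrakk>x \<noteq> z; norm (x - z) < r\<rbrakk> \<Longrightarrow> c / norm (x - z) powr (real DIM('a) + 2 * s) \<le> K x z"
    and K_upper: "x \<noteq> z \<Longrightarrow> K x z \<le> C / norm (x - z) powr (real DIM('a) + 2 * s)"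
begin

section \<open>The bilinear form of the kernel\<close>

definition kernel :: "'a \<times> 'a \<Rightarrow> real" where
  "kernel p = K (fst p) (snd p)"

lemma measurable_kernel [measurable]: "kernel \<in> borel_measurable lebesgue"
  using K_measurable by (simp add: kernel_def[abs_def])

lemma kernel_nonneg [simp]: "0 \<le> kernel p"
  by (simp add: kernel_def K_nonneg)

definition form :: "('a \<Rightarrow> real) \<Rightarrow> ('a \<Rightarrow> real) \<Rightarrow> real" where
  "form u v = (\<integral>p. incr u p * incr v p * kernel p \<partial>lebesgue)"

text \<open>From |x y| \<le> x^2 + y^2 and the upper bound on the kernel. The right side is
  integrable for members of \<open>Hs s\<close>, which makes \<open>form\<close> a genuine integral
  there.\<close>

lemma abs_incr_mult_kernel_le:
  "\<bar>incr u p * incr v p * kernel p\<bar> \<le> C * ((incr u p)\<^sup>2 / weight s p) + C * ((incr v p)\<^sup>2 / weight s p)"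
proof (cases "fst p = snd p")
  case False
  have "\<bar>incr u p * incr v p\<bar> \<le> (incr u p)\<^sup>2 + (incr v p)\<^sup>2"
    using zero_le_power2[of "\<bar>incr u p\<bar> - \<bar>incr v p\<bar>"]
      mult_nonneg_nonneg[OF abs_ge_zero abs_ge_zero, of "incr u p" "incr v p"]
    unfolding power2_diff abs_mult power2_abs by linarith
  moreover have "kernel p \<le> C / weight s p"
    using K_upper[OF False] by (simp add: kernel_def weight_def)
  ultimately have "\<bar>incr u p * incr v p\<bar> * kernel p \<le> ((incr u p)\<^sup>2 + (incr v p)\<^sup>2) * (C / weight s p)"
    by (intro mult_mono) auto
  then show ?thesis by (simp add: abs_mult algebra_simps add_divide_distrib)
qed (use C_pos in \<open>simp add: incr_def\<close>)

lemma integrable_form: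
  assumes u: "u \<in> Hs s" and v: "v \<in> Hs s"
  shows "integrable lebesgue (\<lambda>p. incr u p * incr v p * kernel p)"
proof -
  have [measurable]: "u \<in> borel_measurable lebesgue" "v \<in> borel_measurable lebesgue"
    using u v by (auto simp: Hs_iff)
  have "integrable lebesgue (\<lambda>p. C * ((incr u p)\<^sup>2 / weight s p) + C * ((incr v p)\<^sup>2 / weight s p))"
    using u v by (intro Bochner_Integration.integrable_add integrable_mult_right) (auto simp: Hs_iff)
  then show ?thesis
    by (rule Bochner_Integration.integrable_bound) (auto intro!: AE_I2 order_trans[OF abs_incr_mult_kernel_le])
qed

lemma form_self_nonneg: "0 \<le> form u u"
  by (auto simp: form_def intro!: Bochner_Integration.integral_nonneg)

lemma nn_integral_form:
  assumes "u \<in> Hs s"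
  shows "(\<integral>\<^sup>+p. ennreal ((incr u p)\<^sup>2 * kernel p) \<partial>lebesgue) = ennreal (form u u)"
  using nn_integral_eq_integral[OF integrable_form[OF assms assms]]
  by (simp add: form_def power2_eq_square)

lemma form_add_scaled:
  assumes u: "u \<in> Hs s" and v: "v \<in> Hs s"
  shows "form (\<lambda>x. u x + t * v x) (\<lambda>x. u x + t * v x) = form u u + 2 * t * form u v + t\<^sup>2 * form v v"
proof -
  have "(\<lambda>p. incr (\<lambda>x. u x + t * v x) p * incr (\<lambda>x. u x + t * v x) p * kernel p)
     = (\<lambda>p. incr u p * incr u p * kernel p + 2 * t * (incr u p * incr v p * kernel p)
        + t\<^sup>2 * (incr v p * incr v p * kernel p))"
    by (auto simp: incr_def algebra_simps power2_eq_square)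
  then show ?thesis
    unfolding form_def using integrable_form[OF u u] integrable_form[OF u v] integrable_form[OF v v]
    by simp
qed

lemma form_parallelogram:
  assumes u: "u \<in> Hs s" and v: "v \<in> Hs s"
  shows "form (\<lambda>x. (u x + v x) / 2) (\<lambda>x. (u x + v x) / 2) + form (\<lambda>x. u x - v x) (\<lambda>x. u x - v x) / 4
     = (form u u + form v v) / 2"
proof -
  have uv: "(\<lambda>x. u x - v x) \<in> Hs s" using Hs_lincomb[OF u v, of 1 "-1"] by simp
  \<comment> \<open>The midpoint and \<open>v\<close> are the points t = -1/2 and t = -1 of the line
    u + t (u - v). Expanding the form at both and eliminating the mixed term gives the
    identity.\<close>
  have "(\<lambda>x. (u x + v x) / 2) = (\<lambda>x. u x + (- 1/2) * (u x - v x))" by (auto simp: field_simps)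
  then have 1: "form (\<lambda>x. (u x + v x) / 2) (\<lambda>x. (u x + v x) / 2)
      = form u u - form u (\<lambda>x. u x - v x) + form (\<lambda>x. u x - v x) (\<lambda>x. u x - v x) / 4"
    using form_add_scaled[OF u uv, of "-1/2"] by (simp add: power2_eq_square)
  have "v = (\<lambda>x. u x + (- 1) * (u x - v x))" by auto
  then have "form v v = form u u - 2 * form u (\<lambda>x. u x - v x) + form (\<lambda>x. u x - v x) (\<lambda>x. u x - v x)"
    using form_add_scaled[OF u uv, of "-1"] by simp
  with 1 show ?thesis by simp
qed

lemma form_contraction_le:
  assumes u: "u \<in> Hs s" and T: "\<And>x y :: real. \<bar>T x - T y\<bar> \<le> \<bar>x - y\<bar>" "T 0 = 0"
  shows "form (\<lambda>x. T (u x)) (\<lambda>x. T (u x)) \<le> form u u"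
  unfolding form_def
proof (rule integral_mono)
  show "integrable lebesgue (\<lambda>p. incr (\<lambda>x. T (u x)) p * incr (\<lambda>x. T (u x)) p * kernel p)"
    using Hs_contraction[OF u T] by (intro integrable_form)
  show "integrable lebesgue (\<lambda>p. incr u p * incr u p * kernel p)"
    using u by (intro integrable_form)
  show "incr (\<lambda>x. T (u x)) p * incr (\<lambda>x. T (u x)) p * kernel p \<le> incr u p * incr u p * kernel p" for p
    using T(1) by (intro mult_right_mono) (simp_all add: incr_def abs_le_square_iff[unfolded power2_eq_square, symmetric])
qed

lemma near_diagonal_le:
  "ennreal ((incr w p)\<^sup>2 / weight s p) * indicator {p. norm (fst p - snd p) < r} p
    \<le> ennreal (1 / c) * ennreal ((incr w p)\<^sup>2 * kernel p)"
proof (cases "fst p \<noteq> snd p \<and> norm (fst p - snd p) < r")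
  case True
  then have "c / weight s p \<le> kernel p"
    using K_lower by (simp add: kernel_def weight_def)
  then have "(incr w p)\<^sup>2 * (c / weight s p) \<le> (incr w p)\<^sup>2 * kernel p"
    by (rule mult_left_mono) simp
  then have "(incr w p)\<^sup>2 / weight s p \<le> 1 / c * ((incr w p)\<^sup>2 * kernel p)"
    using c_pos by (simp add: field_simps)
  then show ?thesis using True c_pos
    by (simp add: ennreal_mult[symmetric] ennreal_leI)
qed (auto simp: incr_def)

text \<open>At distance below r the weight is at most r^q, with q = n + 2 s, so a squared increment
  is at most r^q times the Gagliardo integrand, hence at most r^q / c times the integrand of the
  form.\<close>

lemma poincare:
  obtains P where "0 < P" "\<And>w. w \<in> Hs0 s \<Omega> \<Longrightarrow> (\<integral>\<^sup>+x. ennreal ((w x)\<^sup>2) \<partial>lebesgue) \<le> ennreal (P * form w w)"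
proof -
  obtain R where R: "\<Omega> \<subseteq> ball 0 R" using \<Omega>_bounded bounded_subset_ballD by blast
  obtain P where P: "0 < P" "\<And>w :: 'a \<Rightarrow> real. w \<in> borel_measurable lebesgue \<Longrightarrow>
      (AE x in lebesgue. R \<le> norm x \<longrightarrow> w x = 0) \<Longrightarrow>
      (\<integral>\<^sup>+x. ennreal ((w x)\<^sup>2) \<partial>lebesgue) \<le> ennreal P *
      (\<integral>\<^sup>+p. ennreal ((w (fst p) - w (snd p))\<^sup>2) * indicator {p. norm (fst p - snd p) < r} p \<partial>lebesgue)"
    using poincare_lebesgue[OF r_pos] by blast
  define q where "q = real DIM('a) + 2 * s"
  have q: "0 < q" using s_pos by (simp add: q_def add_nonneg_pos)
  show ?thesis
  proof (rule that)
    show "0 < P * (r powr q * (1 / c))" using P(1) r_pos c_pos by simp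
    fix w assume w: "w \<in> Hs0 s \<Omega>"
    then have ws: "w \<in> Hs s" by (simp add: Hs0_def)
    then have [measurable]: "w \<in> borel_measurable lebesgue" by (simp add: Hs_iff)
    have "AE x in lebesgue. x \<notin> \<Omega> \<longrightarrow> w x = 0" using w by (simp add: Hs0_def)
    then have w0: "AE x in lebesgue. R \<le> norm x \<longrightarrow> w x = 0"
      by eventually_elim (use R in auto)
    have pw: "ennreal ((incr w p)\<^sup>2) * indicator {p. norm (fst p - snd p) < r} p
        \<le> ennreal (r powr q) * (ennreal (1 / c) * ennreal ((incr w p)\<^sup>2 * kernel p))" for p
    proof (cases "fst p \<noteq> snd p \<and> norm (fst p - snd p) < r")
      case True
      then have wt: "0 < weight s p" "weight s p \<le> r powr q"
        using q by (auto simp: weight_def q_def[symmetric] intro!: powr_mono2)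
      have "(incr w p)\<^sup>2 = weight s p * ((incr w p)\<^sup>2 / weight s p)" using wt by simp
      also have "\<dots> \<le> r powr q * ((incr w p)\<^sup>2 / weight s p)"
        using wt by (intro mult_right_mono) auto
      finally have "ennreal ((incr w p)\<^sup>2) \<le> ennreal (r powr q) * ennreal ((incr w p)\<^sup>2 / weight s p)"
        by (simp add: ennreal_mult[symmetric] ennreal_leI)
      also have "\<dots> \<le> ennreal (r powr q) * (ennreal (1 / c) * ennreal ((incr w p)\<^sup>2 * kernel p))"
        using near_diagonal_le[of w p] True by (intro mult_left_mono) auto
      finally show ?thesis using True by simp
    qed (auto simp: incr_def)
    have "(\<integral>\<^sup>+x. ennreal ((w x)\<^sup>2) \<partial>lebesgue) \<le> ennreal P *
      (\<integral>\<^sup>+p. ennreal ((incr w p)\<^sup>2) * indicator {p. norm (fst p - snd p) < r} p \<partial>lebesgue)"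
      using P(2)[OF _ w0] by (simp add: incr_def)
    also have "\<dots> \<le> ennreal P *
      (\<integral>\<^sup>+p. ennreal (r powr q) * (ennreal (1 / c) * ennreal ((incr w p)\<^sup>2 * kernel p)) \<partial>lebesgue)"
      by (intro mult_left_mono nn_integral_mono pw) simp
    also have "\<dots> = ennreal P * (ennreal (r powr q) * (ennreal (1 / c) * ennreal (form w w)))"
      by (simp add: nn_integral_cmult nn_integral_form[OF ws])
    also have "\<dots> = ennreal (P * (r powr q * (1 / c)) * form w w)"
      using P(1) c_pos form_self_nonneg[of w]
      by (simp add: ennreal_mult[symmetric] mult.assoc)
    finally show "(\<integral>\<^sup>+x. ennreal ((w x)\<^sup>2) \<partial>lebesgue) \<le> ennreal (P * (r powr q * (1 / c)) * form w w)" .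
  qed
qed

text \<open>Finite energy controls the Gagliardo integral at distance below r. At larger distance an
  increment is at most 2 k and vanishes unless one of the points lies in \<Omega>, so
  \<open>nn_integral_far_finite\<close> covers the rest. This is how a pointwise limit is recognised
  as a member of the space.\<close>

lemma Hs0_if_finite_energy:
  assumes w[measurable]: "w \<in> borel_measurable lebesgue" and w0: "AE x in lebesgue. x \<notin> \<Omega> \<longrightarrow> w x = 0"
    and wk: "AE x in lebesgue. \<bar>w x\<bar> \<le> k"
    and fin: "(\<integral>\<^sup>+p. ennreal ((incr w p)\<^sup>2 * kernel p) \<partial>lebesgue) < \<infinity>"
  shows "w \<in> Hs0 s \<Omega>"
proof -
  have \<Omega>b: "\<Omega> \<in> sets borel" using \<Omega>_open by simp
  have \<Omega>f: "emeasure lborel \<Omega> < \<infinity>" using emeasure_bounded_finite[OF \<Omega>_bounded] by simp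
  have 1: "integrable lebesgue (\<lambda>x. (w x)\<^sup>2)"
  proof (rule integrableI_bounded_set[where A=\<Omega> and B="k\<^sup>2"])
    show "emeasure lebesgue \<Omega> < \<infinity>" using \<Omega>f \<Omega>b by simp
    show "AE x in lebesgue. x \<in> \<Omega> \<longrightarrow> norm ((w x)\<^sup>2) \<le> k\<^sup>2"
      using wk by eventually_elim (auto simp: abs_le_square_iff[symmetric])
    show "AE x in lebesgue. x \<notin> \<Omega> \<longrightarrow> (w x)\<^sup>2 = 0"
      using w0 by eventually_elim auto
  qed (use \<Omega>b in auto)
  \<comment> \<open>The sum of the two indicators is at least 1 as soon as one point lies in
    \<Omega>; it avoids treating the union of the two cylinders.\<close>
  define far where "far p = (indicator \<Omega> (fst p) + indicator \<Omega> (snd p)) * (indicator {p. r \<le> norm (fst p - snd p)} p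
      * ennreal (1 / weight s p))" for p
  have far: "(\<integral>\<^sup>+p. far p \<partial>lebesgue) < \<infinity>"
    unfolding far_def weight_def using s_pos r_pos \<Omega>b \<Omega>f by (intro nn_integral_far_finite) auto
  have [measurable]: "\<Omega> \<in> sets lebesgue" using \<Omega>b by simp
  have i1: "(\<lambda>p. indicator \<Omega> (fst p) :: ennreal) \<in> borel_measurable lebesgue"
    by (rule measurable_compose[OF measurable_fst_lebesgue]) simp
  have i2: "(\<lambda>p. indicator \<Omega> (snd p) :: ennreal) \<in> borel_measurable lebesgue"
    by (rule measurable_compose[OF measurable_snd_lebesgue]) simp
  have [measurable]: "far \<in> borel_measurable lebesgue" unfolding far_def
    using i1 i2 by measurable
  have "AE p in lebesgue. ennreal ((incr w p)\<^sup>2 / weight s p)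
     \<le> ennreal (1 / c) * ennreal ((incr w p)\<^sup>2 * kernel p) + ennreal (4 * k\<^sup>2) * far p"
    using AE_lebesgue_fst[OF w0, where 'b='a] AE_lebesgue_snd[OF w0, where 'a='a]
      AE_lebesgue_fst[OF wk, where 'b='a] AE_lebesgue_snd[OF wk, where 'a='a]
  proof eventually_elim
    case (elim p)
    show ?case
    proof (cases "norm (fst p - snd p) < r")
      case True
      then show ?thesis using near_diagonal_le[of w p] by (simp add: add_increasing2)
    next
      case False
      show ?thesis
      proof (cases "fst p \<in> \<Omega> \<or> snd p \<in> \<Omega>")
        case True
        have "\<bar>incr w p\<bar> \<le> 2 * k" using elim by (auto simp: incr_def)
        then have "(incr w p)\<^sup>2 \<le> (2 * k)\<^sup>2"
          using power_mono[OF _ abs_ge_zero, of "incr w p" "2 * k" 2] by simp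
        then have "(incr w p)\<^sup>2 / weight s p \<le> 4 * k\<^sup>2 * (1 / weight s p)"
          using divide_right_mono[of "(incr w p)\<^sup>2" "4 * k\<^sup>2" "weight s p"] by (simp add: power_mult_distrib)
        then have "ennreal ((incr w p)\<^sup>2 / weight s p) \<le> ennreal (4 * k\<^sup>2) * (1 * ennreal (1 / weight s p))"
          by (simp add: ennreal_mult[symmetric] ennreal_leI)
        also have "\<dots> \<le> ennreal (4 * k\<^sup>2) * far p"
          unfolding far_def using True False
          by (intro mult_left_mono mult_mono) (auto simp: indicator_def)
        finally show ?thesis by (simp add: add_increasing)
      next
        case False
        then show ?thesis using elim by (simp add: incr_def)
      qed
    qed
  qed
  then have "(\<integral>\<^sup>+p. ennreal ((incr w p)\<^sup>2 / weight s p) \<partial>lebesgue)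
     \<le> (\<integral>\<^sup>+p. ennreal (1 / c) * ennreal ((incr w p)\<^sup>2 * kernel p) + ennreal (4 * k\<^sup>2) * far p \<partial>lebesgue)"
    by (rule nn_integral_mono_AE)
  also have "\<dots> = ennreal (1 / c) * (\<integral>\<^sup>+p. ennreal ((incr w p)\<^sup>2 * kernel p) \<partial>lebesgue)
       + ennreal (4 * k\<^sup>2) * (\<integral>\<^sup>+p. far p \<partial>lebesgue)"
    by (simp add: nn_integral_add nn_integral_cmult)
  also have "\<dots> < \<infinity>"
    using fin far by (simp add: ennreal_mult_less_top)
  finally have "integrable lebesgue (\<lambda>p. (incr w p)\<^sup>2 / weight s p)"
    by (simp add: integrable_iff_bounded)
  then show ?thesis using 1 w0 by (simp add: Hs0_def Hs_iff)
qed

end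

section \<open>The minimisation problem\<close>

lemma continuous_bounded_on_interval:
  fixes \<phi> :: "real \<Rightarrow> real"
  assumes "continuous_on UNIV \<phi>"
  obtains M where "0 \<le> M" "\<And>t. \<bar>t\<bar> \<le> B \<Longrightarrow> \<bar>\<phi> t\<bar> \<le> M"
proof -
  have "bounded (\<phi> ` {-B..B})"
    using assms by (intro compact_imp_bounded compact_continuous_image) (auto intro: continuous_on_subset)
  then obtain M where "\<forall>t\<in>{-B..B}. \<bar>\<phi> t\<bar> \<le> M" by (auto simp: bounded_iff)
  then show ?thesis by (intro that[of "max M 0"]) (auto simp: abs_le_iff le_max_iff_disj)
qed

text \<open>A bounded \<open>u\<close> stays in a compact interval, on which \<phi> is bounded, so
  the product is dominated by a multiple of \<open>g\<close>. All integrability of reaction, source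
  and potential comes from this.\<close>

lemma integrable_mult_continuous_comp:
  fixes g u :: "'a \<Rightarrow> real"
  assumes g: "integrable M g" and [measurable]: "u \<in> borel_measurable M"
    and B: "AE x in M. \<bar>u x\<bar> \<le> B" and \<phi>: "continuous_on UNIV \<phi>"
  shows "integrable M (\<lambda>x. g x * \<phi> (u x))"
proof -
  have [measurable]: "\<phi> \<in> borel_measurable borel" using \<phi> by (rule borel_measurable_continuous_onI)
  have [measurable]: "g \<in> borel_measurable M" using g by simp
  obtain C where C: "\<And>t. \<bar>t\<bar> \<le> B \<Longrightarrow> \<bar>\<phi> t\<bar> \<le> C" using continuous_bounded_on_interval[OF \<phi>] by blast
  have "integrable M (\<lambda>x. C * g x)" using g by simp
  then show ?thesis
  proof (rule Bochner_Integration.integrable_bound)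
    show "AE x in M. norm (g x * \<phi> (u x)) \<le> norm (C * g x)"
      using B
    proof eventually_elim
      case (elim x)
      then have "\<bar>g x\<bar> * \<bar>\<phi> (u x)\<bar> \<le> \<bar>g x\<bar> * \<bar>C\<bar>"
        using C[of "u x"] by (intro mult_left_mono) auto
      then show ?case by (simp add: abs_mult mult.commute)
    qed
  qed measurable
qed

lemma integrable_mult_bounded:
  fixes g u :: "'a \<Rightarrow> real"
  assumes "integrable M g" "u \<in> borel_measurable M" "AE x in M. \<bar>u x\<bar> \<le> B"
  shows "integrable M (\<lambda>x. g x * u x)"
  using integrable_mult_continuous_comp[OF assms continuous_on_id] by simp

text \<open>\<open>a\<close> and \<open>f\<close> live on the whole space; the problem on \<Omega>
  enters through extension by 0. \<open>H\<close> is any antiderivative of \<open>h\<close>, its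
  value at 0 left open, which is why \<open>H 0\<close> occurs in the lower bounds.\<close>

locale semilinear_problem = nonlocal_form \<Omega> K s c C r
  for \<Omega> :: "'a::euclidean_space set" and K :: "'a \<Rightarrow> 'a \<Rightarrow> real" and s c C r :: real +
  fixes h H :: "real \<Rightarrow> real" and a f :: "'a \<Rightarrow> real" and Q k :: real
  assumes h_cont: "continuous_on UNIV h" and h_mono: "mono h" and h_odd: "h (- t) = - h t"
    and H_deriv: "(H has_real_derivative h t) (at t)"
    and a_int: "integrable lebesgue a" and f_int: "integrable lebesgue f"
    and Q_pos: "0 < Q" and k_pos: "0 < k" and h_k: "h k = Q"
    and f_le: "AE x in lebesgue. \<bar>f x\<bar> \<le> Q * a x"
begin

lemma h_zero [simp]: "h 0 = 0"
  using h_odd[of 0] by simp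

lemma h_mult_nonneg: "0 \<le> (h x - h y) * (x - y)"
  using monoD[OF h_mono, of x y] monoD[OF h_mono, of y x]
  by (cases "x \<le> y") (auto intro: mult_nonpos_nonpos)

text \<open>The slope of \<open>H\<close> between two points is a value of \<open>h\<close> in
  between, and \<open>h\<close> is monotone: the graph of \<open>H\<close> lies above each tangent.
  Convexity of the functional, the effect of truncation and the first variation all rest on this
  inequality, each with its own choice of the point of tangency \<open>x\<close>.\<close>

lemma H_subgradient: "H x - H y \<le> h x * (x - y)"
proof -
  consider "x = y" | "x < y" | "y < x" by linarith
  then show ?thesis
  proof cases
    case 2
    obtain z where z: "x < z" "z < y" "H y - H x = (y - x) * h z"
      using MVT2[OF 2, of H h] H_deriv by auto
    have "(y - x) * h x \<le> (y - x) * h z"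
      using z monoD[OF h_mono, of x z] by (intro mult_left_mono) auto
    then show ?thesis using z by (simp add: algebra_simps)
  next
    case 3
    obtain z where z: "y < z" "z < x" "H x - H y = (x - y) * h z"
      using MVT2[OF 3, of H h] H_deriv by auto
    have "(x - y) * h z \<le> (x - y) * h x"
      using z monoD[OF h_mono, of z x] by (intro mult_left_mono) auto
    then show ?thesis using z by (simp add: algebra_simps)
  qed simp
qed

lemma H_ge: "H 0 \<le> H t"
  using H_subgradient[of 0 t] by simp

lemma H_midpoint: "H ((x + y) / 2) \<le> (H x + H y) / 2"
  using H_subgradient[of "(x + y) / 2" x] H_subgradient[of "(x + y) / 2" y]
  by (simp add: field_simps)

lemma H_cont: "continuous_on UNIV H"
  using H_deriv DERIV_isCont by (auto simp: continuous_on_eq_continuous_at)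

lemma h_measurable [measurable]: "h \<in> borel_measurable borel"
  using h_cont by (rule borel_measurable_continuous_onI)

lemma H_measurable [measurable]: "H \<in> borel_measurable borel"
  using H_cont by (rule borel_measurable_continuous_onI)

lemma a_measurable [measurable]: "a \<in> borel_measurable lebesgue"
  using a_int by simp

lemma f_measurable [measurable]: "f \<in> borel_measurable lebesgue"
  using f_int by simp

text \<open>The sign of \<open>a\<close> is forced by 0 \<le> |f| \<le> Q a with Q > 0.\<close>

lemma a_nonneg: "AE x in lebesgue. 0 \<le> a x"
  using f_le
proof eventually_elim
  case (elim x)
  have "0 \<le> Q * a x" using elim abs_ge_zero order_trans by blast
  then show ?case using Q_pos by (simp add: zero_le_mult_iff)
qed

section \<open>Test space and functional\<close>

definition X :: "('a \<Rightarrow> real) set" where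
  "X = {u \<in> Hs0 s \<Omega>. \<exists>B. AE x in lebesgue. \<bar>u x\<bar> \<le> B}"

lemma X_lincomb:
  assumes "u \<in> X" "v \<in> X"
  shows "(\<lambda>x. \<alpha> * u x + \<beta> * v x) \<in> X"
proof -
  obtain A B where "AE x in lebesgue. \<bar>u x\<bar> \<le> A" "AE x in lebesgue. \<bar>v x\<bar> \<le> B"
    using assms by (auto simp: X_def)
  then have "AE x in lebesgue. \<bar>\<alpha> * u x + \<beta> * v x\<bar> \<le> \<bar>\<alpha>\<bar> * A + \<bar>\<beta>\<bar> * B"
  proof eventually_elim
    case (elim x)
    have "\<bar>\<alpha> * u x + \<beta> * v x\<bar> \<le> \<bar>\<alpha>\<bar> * \<bar>u x\<bar> + \<bar>\<beta>\<bar> * \<bar>v x\<bar>"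
      by (rule order_trans[OF abs_triangle_ineq]) (simp add: abs_mult)
    also have "\<dots> \<le> \<bar>\<alpha>\<bar> * A + \<bar>\<beta>\<bar> * B" using elim by (intro add_mono mult_left_mono) auto
    finally show ?case .
  qed
  then show ?thesis using assms Hs0_lincomb by (auto simp: X_def)
qed

lemma X_Hs: "u \<in> X \<Longrightarrow> u \<in> Hs s"
  by (simp add: X_def Hs0_def)

lemma X_measurable: "u \<in> X \<Longrightarrow> u \<in> borel_measurable lebesgue"
  by (rule Hs_measurable[OF X_Hs])

lemma integrable_reaction:
  assumes "u \<in> borel_measurable lebesgue" "AE x in lebesgue. \<bar>u x\<bar> \<le> A"
    "v \<in> borel_measurable lebesgue" "AE x in lebesgue. \<bar>v x\<bar> \<le> B"
  shows "integrable lebesgue (\<lambda>x. a x * h (u x) * v x)"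
  using integrable_mult_bounded[OF integrable_mult_continuous_comp[OF a_int assms(1,2) h_cont] assms(3,4)] .

definition potential :: "('a \<Rightarrow> real) \<Rightarrow> real" where
  "potential u = (\<integral>x. a x * H (u x) - f x * u x \<partial>lebesgue)"

text \<open>The factor 1/4 is chosen so that the derivative of the quadratic part in direction v is
  \<open>form u v / 2\<close>, as in the weak equation.\<close>

definition energy :: "('a \<Rightarrow> real) \<Rightarrow> real" where
  "energy u = form u u / 4 + potential u"

lemma integrable_potential:
  assumes "u \<in> borel_measurable lebesgue" "AE x in lebesgue. \<bar>u x\<bar> \<le> B"
  shows "integrable lebesgue (\<lambda>x. a x * H (u x) - f x * u x)"
  using integrable_mult_continuous_comp[OF a_int assms H_cont] integrable_mult_bounded[OF f_int assms]
  by simp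

text \<open>\<open>H\<close> is smallest at 0 because \<open>h 0 = 0\<close>, and |u| \<le> k bounds
  the source term. The lower bound does not depend on \<open>u\<close>, so the infimum is
  finite.\<close>

lemma potential_ge:
  assumes u: "u \<in> borel_measurable lebesgue" "AE x in lebesgue. \<bar>u x\<bar> \<le> k"
  shows "(\<integral>x. a x * H 0 - k * \<bar>f x\<bar> \<partial>lebesgue) \<le> potential u"
  unfolding potential_def
proof (rule integral_mono_AE)
  show "integrable lebesgue (\<lambda>x. a x * H 0 - k * \<bar>f x\<bar>)" using a_int f_int by auto
  show "integrable lebesgue (\<lambda>x. a x * H (u x) - f x * u x)" by (rule integrable_potential[OF u])
  show "AE x in lebesgue. a x * H 0 - k * \<bar>f x\<bar> \<le> a x * H (u x) - f x * u x"
    using u(2) a_nonneg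
  proof eventually_elim
    case (elim x)
    have "a x * H 0 \<le> a x * H (u x)" using elim H_ge by (intro mult_left_mono)
    moreover have "f x * u x \<le> \<bar>f x\<bar> * \<bar>u x\<bar>" by (metis abs_ge_self abs_mult)
    moreover have "\<bar>f x\<bar> * \<bar>u x\<bar> \<le> \<bar>f x\<bar> * k" using elim by (intro mult_left_mono) auto
    ultimately show ?case by (simp add: mult.commute)
  qed
qed

lemma potential_midpoint:
  assumes u: "u \<in> borel_measurable lebesgue" "AE x in lebesgue. \<bar>u x\<bar> \<le> k"
    and v: "v \<in> borel_measurable lebesgue" "AE x in lebesgue. \<bar>v x\<bar> \<le> k"
  shows "potential (\<lambda>x. (u x + v x) / 2) \<le> (potential u + potential v) / 2"
proof -
  have [measurable]: "u \<in> borel_measurable lebesgue" "v \<in> borel_measurable lebesgue" by fact+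
  have 1: "AE x in lebesgue. \<bar>(u x + v x) / 2\<bar> \<le> k"
    using u(2) v(2) by eventually_elim auto
  have "potential (\<lambda>x. (u x + v x) / 2)
      \<le> (\<integral>x. (a x * H (u x) - f x * u x) / 2 + (a x * H (v x) - f x * v x) / 2 \<partial>lebesgue)"
    unfolding potential_def
  proof (rule integral_mono_AE)
    show "integrable lebesgue (\<lambda>x. a x * H ((u x + v x) / 2) - f x * ((u x + v x) / 2))"
      by (rule integrable_potential[OF _ 1]) measurable
    show "integrable lebesgue (\<lambda>x. (a x * H (u x) - f x * u x) / 2 + (a x * H (v x) - f x * v x) / 2)"
      using integrable_potential[OF u] integrable_potential[OF v] by auto
    show "AE x in lebesgue. a x * H ((u x + v x) / 2) - f x * ((u x + v x) / 2)
       \<le> (a x * H (u x) - f x * u x) / 2 + (a x * H (v x) - f x * v x) / 2"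
      using a_nonneg
    proof eventually_elim
      case (elim x)
      have "a x * H ((u x + v x) / 2) \<le> a x * ((H (u x) + H (v x)) / 2)"
        using elim H_midpoint by (intro mult_left_mono)
      then show ?case by (simp add: field_simps)
    qed
  qed
  also have "\<dots> = (potential u + potential v) / 2"
    unfolding potential_def using integrable_potential[OF u] integrable_potential[OF v] by simp
  finally show ?thesis .
qed

lemma potential_tendsto:
  assumes u[measurable]: "\<And>n. u n \<in> borel_measurable lebesgue" "v \<in> borel_measurable lebesgue"
    and B: "\<And>n. AE x in lebesgue. \<bar>u n x\<bar> \<le> B"
    and lim: "AE x in lebesgue. (\<lambda>n. u n x) \<longlonglongrightarrow> v x"
  shows "(\<lambda>n. potential (u n)) \<longlonglongrightarrow> potential v"
proof -
  obtain M where M: "0 \<le> M" "\<And>t. \<bar>t\<bar> \<le> B \<Longrightarrow> \<bar>H t\<bar> \<le> M"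
    using continuous_bounded_on_interval[OF H_cont] by blast
  show ?thesis
    unfolding potential_def
  proof (rule integral_dominated_convergence[where w="\<lambda>x. \<bar>a x\<bar> * M + \<bar>f x\<bar> * B"])
    show "integrable lebesgue (\<lambda>x. \<bar>a x\<bar> * M + \<bar>f x\<bar> * B)" using a_int f_int by auto
    show "AE x in lebesgue. (\<lambda>n. a x * H (u n x) - f x * u n x) \<longlonglongrightarrow> a x * H (v x) - f x * v x"
      using lim
    proof eventually_elim
      case (elim x)
      have "isCont H (v x)" using H_deriv DERIV_isCont by blast
      then show ?case using elim by (intro tendsto_intros isCont_tendsto_compose[of _ H])
    qed
    show "AE x in lebesgue. norm (a x * H (u n x) - f x * u n x) \<le> \<bar>a x\<bar> * M + \<bar>f x\<bar> * B" for n
      using B[of n]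
    proof eventually_elim
      case (elim x)
      have "\<bar>a x * H (u n x) - f x * u n x\<bar> \<le> \<bar>a x\<bar> * \<bar>H (u n x)\<bar> + \<bar>f x\<bar> * \<bar>u n x\<bar>"
        by (rule order_trans[OF abs_triangle_ineq4]) (simp add: abs_mult)
      also have "\<dots> \<le> \<bar>a x\<bar> * M + \<bar>f x\<bar> * B"
        using elim M(2)[OF elim] by (intro add_mono mult_left_mono) auto
      finally show ?case by simp
    qed
  qed measurable
qed

section \<open>Truncation at the level where reaction and source balance\<close>

definition trunc :: "real \<Rightarrow> real" where
  "trunc t = max (- k) (min k t)"

lemma abs_trunc_le: "\<bar>trunc t\<bar> \<le> k"
  using k_pos by (auto simp: trunc_def)

lemma trunc_contraction: "\<bar>trunc x - trunc y\<bar> \<le> \<bar>x - y\<bar>"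
  by (auto simp: trunc_def max_def min_def)

lemma trunc_zero: "trunc 0 = 0"
  using k_pos by (simp add: trunc_def)

text \<open>Beyond the level \<open>k\<close> the reaction \<open>a h(t)\<close> dominates the source, since \<open>\<bar>f\<bar> \<le> Q a = a h(k)\<close>.\<close>

lemma trunc_potential_le:
  assumes "\<bar>f x\<bar> \<le> Q * a x"
  shows "a x * H (trunc t) - f x * trunc t \<le> a x * H t - f x * t"
proof -
  have Qa: "0 \<le> Q * a x" using assms abs_ge_zero order_trans by blast
  then have a: "0 \<le> a x" using Q_pos by (simp add: zero_le_mult_iff)
  \<comment> \<open>The tangent is taken at \<open>trunc t\<close>, not at t: wherever truncation
    acts, \<open>h (trunc t)\<close> is Q or -Q, exactly the value that can be compared with the
    source. The sign of trunc t - t then decides the direction of the inequality.\<close>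
  have "a x * (H (trunc t) - H t) \<le> a x * (h (trunc t) * (trunc t - t))"
    using a H_subgradient by (intro mult_left_mono)
  also have "\<dots> \<le> f x * (trunc t - t)"
  proof -
    consider "k < t" | "t < - k" | "\<bar>t\<bar> \<le> k" by linarith
    then show ?thesis
    proof cases
      case 1
      then have "trunc t = k" using k_pos by (simp add: trunc_def)
      moreover have "a x * Q * (k - t) \<le> f x * (k - t)"
        using 1 assms by (intro mult_right_mono_neg) (auto simp: mult.commute)
      ultimately show ?thesis by (simp add: h_k mult.assoc)
    next
      case 2
      then have t: "trunc t = - k" using k_pos by (simp add: trunc_def)
      have "- (a x * Q) * (- k - t) \<le> f x * (- k - t)"
        using 2 assms by (intro mult_right_mono) (auto simp: mult.commute)
      then show ?thesis by (simp add: t h_k h_odd mult.assoc)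
    next
      case 3
      then have "trunc t = t" by (auto simp: trunc_def)
      then show ?thesis by simp
    qed
  qed
  finally show ?thesis by (simp add: algebra_simps)
qed

lemma energy_trunc_le:
  assumes u: "u \<in> X"
  shows "energy (\<lambda>x. trunc (u x)) \<le> energy u"
proof -
  obtain B where B: "AE x in lebesgue. \<bar>u x\<bar> \<le> B" using u by (auto simp: X_def)
  have us: "u \<in> Hs s" and um: "u \<in> borel_measurable lebesgue" using u by (auto intro: X_Hs X_measurable)
  have tm: "(\<lambda>x. trunc (u x)) \<in> borel_measurable lebesgue"
    by (rule Hs_measurable[OF Hs_contraction[OF us trunc_contraction trunc_zero]])
  have "form (\<lambda>x. trunc (u x)) (\<lambda>x. trunc (u x)) \<le> form u u"
    by (rule form_contraction_le[OF us trunc_contraction trunc_zero])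
  moreover have "potential (\<lambda>x. trunc (u x)) \<le> potential u"
    unfolding potential_def
    using f_le by (intro integral_mono_AE integrable_potential[OF um B] integrable_potential[OF tm, of k])
      (auto simp: abs_trunc_le trunc_potential_le elim!: eventually_mono)
  ultimately show ?thesis by (simp add: energy_def)
qed

section \<open>Minimising sequences and their limit\<close>

definition admissible :: "('a \<Rightarrow> real) set" where
  "admissible = {u \<in> Hs0 s \<Omega>. AE x in lebesgue. \<bar>u x\<bar> \<le> k}"

lemma admissible_subset_X: "admissible \<subseteq> X"
  by (auto simp: admissible_def X_def)

lemma energy_bdd_below: "bdd_below (energy ` admissible)"
proof (rule bdd_belowI2)
  fix u assume "u \<in> admissible"
  then show "(\<integral>x. a x * H 0 - k * \<bar>f x\<bar> \<partial>lebesgue) \<le> energy u"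
    using potential_ge[of u] form_self_nonneg[of u]
    by (auto simp: energy_def admissible_def Hs0_def Hs_def)
qed

text \<open>The midpoint is admissible, so its energy is at least the infimum; the potential is
  midpoint convex and the form gains a quarter of the form of the difference. The weight 1/4 of the
  form in the energy turns this quarter into 1/16.\<close>

lemma form_diff_le_energy_gap:
  assumes u: "u \<in> admissible" and v: "v \<in> admissible"
  shows "form (\<lambda>x. u x - v x) (\<lambda>x. u x - v x) / 16 \<le> (energy u + energy v) / 2 - Inf (energy ` admissible)"
proof -
  have us: "u \<in> Hs s" "AE x in lebesgue. \<bar>u x\<bar> \<le> k" and vs: "v \<in> Hs s" "AE x in lebesgue. \<bar>v x\<bar> \<le> k"
    using u v by (auto simp: admissible_def Hs0_def)
  have "(\<lambda>x. (u x + v x) / 2) \<in> Hs0 s \<Omega>"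
    using Hs0_lincomb[of u s \<Omega> v "1/2" "1/2"] u v by (simp add: admissible_def add_divide_distrib)
  moreover have "AE x in lebesgue. \<bar>(u x + v x) / 2\<bar> \<le> k"
    using us(2) vs(2) by eventually_elim auto
  ultimately have "(\<lambda>x. (u x + v x) / 2) \<in> admissible" by (simp add: admissible_def)
  then have "Inf (energy ` admissible) \<le> energy (\<lambda>x. (u x + v x) / 2)"
    by (intro cInf_lower energy_bdd_below) auto
  moreover have "potential (\<lambda>x. (u x + v x) / 2) \<le> (potential u + potential v) / 2"
    using us vs by (intro potential_midpoint Hs_measurable)
  ultimately show ?thesis
    using form_parallelogram[OF us(1) vs(1)] by (simp add: energy_def field_simps)
qed

text \<open>The rate \<open>16\<^sup>-\<^sup>n\<close> makes \<open>\<Sum> 4\<^sup>n (u\<^bsub>n+1\<^esub> - u\<^sub>n)\<^sup>2\<close> integrable, so the increments decay like \<open>2\<^sup>-\<^sup>n\<close> a.e.\<close>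

lemma minimizing_sequence_converges:
  assumes u: "\<And>n. u n \<in> admissible"
    and uJ: "\<And>n. energy (u n) < Inf (energy ` admissible) + (1 / 16) ^ n"
  shows "AE x in lebesgue. convergent (\<lambda>n. u n x)"
proof -
  define d where "d n x = u (Suc n) x - u n x" for n x
  obtain P where P: "0 < P" "\<And>w. w \<in> Hs0 s \<Omega> \<Longrightarrow> (\<integral>\<^sup>+x. ennreal ((w x)\<^sup>2) \<partial>lebesgue) \<le> ennreal (P * form w w)"
    using poincare by blast
  have dX: "d n \<in> Hs0 s \<Omega>" for n
    using Hs0_lincomb[of "u (Suc n)" s \<Omega> "u n" 1 "-1"] u by (simp add: d_def[abs_def] admissible_def)
  then have [measurable]: "d n \<in> borel_measurable lebesgue" for n by (simp add: Hs0_def Hs_def)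
  have dE: "form (d n) (d n) \<le> 16 * (1 / 16) ^ n" for n
  proof -
    define e e' where "e = (1 / 16 :: real) ^ n" and "e' = (1 / 16 :: real) ^ Suc n"
    have "e' \<le> e" by (simp add: e_def e'_def)
    moreover have "form (d n) (d n) / 16 \<le> (energy (u (Suc n)) + energy (u n)) / 2 - Inf (energy ` admissible)"
      using form_diff_le_energy_gap[OF u u, of "Suc n" n] by (simp add: d_def[abs_def])
    moreover have "energy (u n) < Inf (energy ` admissible) + e"
      "energy (u (Suc n)) < Inf (energy ` admissible) + e'"
      using uJ[of n] uJ[of "Suc n"] by (simp_all only: e_def e'_def)
    ultimately have "form (d n) (d n) \<le> 16 * e" by (simp add: field_simps)
    then show ?thesis by (simp add: e_def)
  qed
  \<comment> \<open>By the Poincare inequality the integral of the squared increment number n is at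
    most 16 P 16^(-n). The factor 4^n still leaves a convergent geometric series of ratio
    1/4.\<close>
  have "(\<integral>\<^sup>+x. (\<Sum>n. ennreal (4 ^ n * (d n x)\<^sup>2)) \<partial>lebesgue)
      = (\<Sum>n. ennreal (4 ^ n) * (\<integral>\<^sup>+x. ennreal ((d n x)\<^sup>2) \<partial>lebesgue))"
    by (simp add: nn_integral_suminf ennreal_mult nn_integral_cmult)
  also have "\<dots> \<le> (\<Sum>n. ennreal (16 * P * (1 / 4) ^ n))"
  proof (intro suminf_le)
    fix n
    have "ennreal (4 ^ n) * (\<integral>\<^sup>+x. ennreal ((d n x)\<^sup>2) \<partial>lebesgue) \<le> ennreal (4 ^ n) * ennreal (P * form (d n) (d n))"
      using P(2)[OF dX] by (intro mult_left_mono) auto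
    also have "\<dots> \<le> ennreal (4 ^ n) * ennreal (P * (16 * (1 / 16) ^ n))"
      using P(1) dE by (intro mult_left_mono ennreal_leI) auto
    also have "\<dots> = ennreal (16 * P * (4 ^ n * (1 / 16) ^ n))"
      using P(1) by (simp add: ennreal_mult[symmetric] ac_simps)
    also have "(4 :: real) ^ n * (1 / 16) ^ n = (1 / 4) ^ n"
      by (simp add: power_mult_distrib[symmetric])
    finally show "ennreal (4 ^ n) * (\<integral>\<^sup>+x. ennreal ((d n x)\<^sup>2) \<partial>lebesgue) \<le> ennreal (16 * P * (1 / 4) ^ n)" .
  qed auto
  also have "\<dots> < \<infinity>"
    using P(1) by (subst suminf_ennreal2) (auto intro!: summable_mult summable_geometric)
  finally have "AE x in lebesgue. (\<Sum>n. ennreal (4 ^ n * (d n x)\<^sup>2)) \<noteq> \<infinity>"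
    by (intro nn_integral_PInf_AE) auto
  then show ?thesis
  proof eventually_elim
    case (elim x)
    have "\<exists>S\<ge>0. y = ennreal S" if "y \<noteq> \<infinity>" for y
      using that by (cases y) auto
    from this[OF elim] obtain S where S: "0 \<le> S" "(\<Sum>n. ennreal (4 ^ n * (d n x)\<^sup>2)) = ennreal S"
      by blast
    have d_le: "norm (d n x) \<le> sqrt S * (1 / 2) ^ n" for n
    proof -
      have "(\<Sum>i\<in>{n}. ennreal (4 ^ i * (d i x)\<^sup>2)) \<le> (\<Sum>n. ennreal (4 ^ n * (d n x)\<^sup>2))"
        by (rule sum_le_suminf) auto
      then have "4 ^ n * (d n x)\<^sup>2 \<le> S" using S by simp
      moreover have "((2 :: real) ^ n)\<^sup>2 = 4 ^ n"
        by (simp add: power2_eq_square power_mult_distrib[symmetric])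
      ultimately have "(2 ^ n * \<bar>d n x\<bar>)\<^sup>2 \<le> S" by (simp only: power_mult_distrib power2_abs)
      then have "2 ^ n * \<bar>d n x\<bar> \<le> sqrt S" by (rule real_le_rsqrt)
      then have "(2 ^ n * \<bar>d n x\<bar>) * (1 / 2) ^ n \<le> sqrt S * (1 / 2) ^ n" by (rule mult_right_mono) simp
      moreover have "(2 ^ n * \<bar>d n x\<bar>) * (1 / 2) ^ n = ((2 :: real) ^ n * (1 / 2) ^ n) * norm (d n x)"
        by (simp only: ac_simps real_norm_def)
      moreover have "(2 :: real) ^ n * (1 / 2) ^ n = 1"
        by (subst power_mult_distrib[symmetric]) simp
      ultimately show ?thesis by (simp only: mult_1)
    qed
    have "summable (\<lambda>n. sqrt S * (1 / 2) ^ n)"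
      by (intro summable_mult summable_geometric) simp
    then have "summable (\<lambda>n. d n x)"
      by (rule summable_comparison_test'[OF _ d_le])
    then have "convergent (\<lambda>n. \<Sum>i<n. d i x)" by (simp add: summable_iff_convergent)
    then have "convergent (\<lambda>n. u n x - u 0 x)"
      by (simp only: d_def sum_lessThan_telescope[of "\<lambda>n. u n x"])
    then have "convergent (\<lambda>n. (u n x - u 0 x) + u 0 x)"
      by (intro convergent_add convergent_const)
    then show ?case by simp
  qed
qed

text \<open>The two parts of the energy pass to the limit differently: the potential converges by
  dominated convergence, thanks to the uniform bound \<open>k\<close>, and the form is lower
  semicontinuous by Fatou.\<close>

lemma energy_attained:
  obtains u where "u \<in> admissible" "energy u \<le> Inf (energy ` admissible)"
proof -
  define m where "m = Inf (energy ` admissible)"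
  have "(\<lambda>x. 0) \<in> admissible" using k_pos by (auto simp: admissible_def Hs0_def Hs_zero)
  then have ne: "energy ` admissible \<noteq> {}" by auto
  have "\<exists>u \<in> admissible. energy u < m + (1 / 16) ^ n" for n :: nat
    using cInf_lessD[OF ne, of "m + (1 / 16) ^ n"] by (auto simp: m_def)
  then obtain u where u: "\<And>n. u n \<in> admissible" "\<And>n. energy (u n) < m + (1 / 16) ^ n"
    by metis
  have us: "u n \<in> Hs s" for n using u(1) by (simp add: admissible_def Hs0_def)
  then have [measurable]: "u n \<in> borel_measurable lebesgue" for n by (simp add: Hs_def)
  \<comment> \<open>Where the sequence diverges \<open>lim\<close> is an unspecified value; this
    happens on a null set, and the resulting function is measurable everywhere.\<close>
  define v where "v x = lim (\<lambda>n. u n x)" for x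
  have v[measurable]: "v \<in> borel_measurable lebesgue" unfolding v_def by (rule borel_measurable_lim_metric) simp
  have "AE x in lebesgue. convergent (\<lambda>n. u n x)"
    by (rule minimizing_sequence_converges[OF u(1)]) (use u(2) in \<open>simp add: m_def\<close>)
  then have lim: "AE x in lebesgue. (\<lambda>n. u n x) \<longlonglongrightarrow> v x"
    by eventually_elim (simp add: v_def convergent_LIMSEQ_iff)
  have uk: "AE x in lebesgue. \<forall>n. \<bar>u n x\<bar> \<le> k"
    using u(1) by (simp add: AE_all_countable admissible_def)
  have u0: "AE x in lebesgue. \<forall>n. x \<notin> \<Omega> \<longrightarrow> u n x = 0"
    unfolding AE_all_countable using u(1) by (simp add: admissible_def Hs0_def)
  have vk: "AE x in lebesgue. \<bar>v x\<bar> \<le> k"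
    using lim uk by eventually_elim (rule LIMSEQ_le_const2[OF tendsto_rabs], auto)
  have v0: "AE x in lebesgue. x \<notin> \<Omega> \<longrightarrow> v x = 0"
    using lim u0 by eventually_elim (auto simp: LIMSEQ_const_iff)
  have m: "m \<le> energy (u n)" for n
    unfolding m_def using u(1) by (intro cInf_lower energy_bdd_below) auto
  have "(\<lambda>n. energy (u n)) \<longlonglongrightarrow> m"
  proof (rule tendsto_sandwich[of "\<lambda>n. m" _ _ "\<lambda>n. m + (1 / 16) ^ n"])
    have "(\<lambda>n. m + (1 / 16) ^ n) \<longlonglongrightarrow> m + 0"
      by (intro tendsto_add tendsto_const LIMSEQ_power_zero) simp
    then show "(\<lambda>n. m + (1 / 16) ^ n) \<longlonglongrightarrow> m" by simp
  qed (use m u(2) in \<open>auto intro!: always_eventually less_imp_le\<close>)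
  moreover have "(\<lambda>n. potential (u n)) \<longlonglongrightarrow> potential v"
    by (rule potential_tendsto[where B=k]) (use u(1) lim in \<open>auto simp: admissible_def\<close>)
  \<comment> \<open>Convergence of the forms is read off by subtraction, since energies and
    potentials both converge.\<close>
  ultimately have "(\<lambda>n. 4 * (energy (u n) - potential (u n))) \<longlonglongrightarrow> 4 * (m - potential v)"
    by (intro tendsto_intros)
  then have fl: "(\<lambda>n. form (u n) (u n)) \<longlonglongrightarrow> 4 * (m - potential v)" by (simp add: energy_def)
  have fl0: "0 \<le> 4 * (m - potential v)"
    by (rule LIMSEQ_le_const[OF fl]) (simp add: form_self_nonneg)
  \<comment> \<open>\<open>v\<close> is not yet known to lie in \<open>Hs s\<close>, so
    \<open>form v v\<close> cannot be used. Fatou is applied to the \<open>ennreal\<close> integral,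
    and its finite bound then supplies the membership.\<close>
  have "(\<integral>\<^sup>+p. ennreal ((incr v p)\<^sup>2 * kernel p) \<partial>lebesgue)
      = (\<integral>\<^sup>+p. liminf (\<lambda>n. ennreal ((incr (u n) p)\<^sup>2 * kernel p)) \<partial>lebesgue)"
  proof (rule nn_integral_cong_AE)
    show "AE p in lebesgue. ennreal ((incr v p)\<^sup>2 * kernel p) = liminf (\<lambda>n. ennreal ((incr (u n) p)\<^sup>2 * kernel p))"
      using AE_lebesgue_fst[OF lim, where 'b='a] AE_lebesgue_snd[OF lim, where 'a='a]
    proof eventually_elim
      case (elim p)
      then have "(\<lambda>n. ennreal ((incr (u n) p)\<^sup>2 * kernel p)) \<longlonglongrightarrow> ennreal ((incr v p)\<^sup>2 * kernel p)"
        unfolding incr_def by (intro tendsto_intros)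
      from lim_imp_Liminf[OF trivial_limit_sequentially this] show ?case by (rule sym)
    qed
  qed
  also have "\<dots> \<le> liminf (\<lambda>n. \<integral>\<^sup>+p. ennreal ((incr (u n) p)\<^sup>2 * kernel p) \<partial>lebesgue)"
    by (rule nn_integral_liminf) measurable
  also have "\<dots> = liminf (\<lambda>n. ennreal (form (u n) (u n)))"
    by (simp add: nn_integral_form[OF us])
  also have "\<dots> = ennreal (4 * (m - potential v))"
    by (intro lim_imp_Liminf tendsto_ennrealI fl) simp
  finally have le: "(\<integral>\<^sup>+p. ennreal ((incr v p)\<^sup>2 * kernel p) \<partial>lebesgue) \<le> ennreal (4 * (m - potential v))" .
  have vX: "v \<in> Hs0 s \<Omega>"
    by (rule Hs0_if_finite_energy[OF v v0 vk]) (use le order_le_less_trans[OF _ ennreal_less_top] in auto)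
  then have "v \<in> Hs s" by (simp add: Hs0_def)
  then have "form v v \<le> 4 * (m - potential v)"
    using le fl0 by (simp add: nn_integral_form ennreal_le_iff)
  then have "energy v \<le> m" by (simp add: energy_def)
  then show ?thesis using that[of v] vX vk by (simp add: admissible_def m_def)
qed

section \<open>Unconstrained minimality and the first variation\<close>

lemma energy_minimizer:
  obtains u where "u \<in> admissible" "\<And>w. w \<in> X \<Longrightarrow> energy u \<le> energy w"
proof -
  obtain u where u: "u \<in> admissible" "energy u \<le> Inf (energy ` admissible)"
    using energy_attained by blast
  show ?thesis
  proof (rule that[OF u(1)])
    fix w assume w: "w \<in> X"
    then have "w \<in> Hs0 s \<Omega>" by (simp add: X_def)
    then have "(\<lambda>x. trunc (w x)) \<in> Hs0 s \<Omega>"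
      by (rule Hs0_contraction[OF _ trunc_contraction trunc_zero])
    then have "(\<lambda>x. trunc (w x)) \<in> admissible" by (simp add: admissible_def abs_trunc_le)
    then have "Inf (energy ` admissible) \<le> energy (\<lambda>x. trunc (w x))"
      by (intro cInf_lower energy_bdd_below) auto
    then show "energy u \<le> energy w" using u(2) energy_trunc_le[OF w] by linarith
  qed
qed

text \<open>Convexity replaces differentiation under the integral: the difference quotient of the
  potential along u + t v is at most the reaction evaluated at u + t v minus the source, both tested
  with v. Letting t decrease to 0 then only requires convergence of the reaction term.\<close>

lemma minimizer_variation_nonneg:
  assumes u: "u \<in> X" and min: "\<And>w. w \<in> X \<Longrightarrow> energy u \<le> energy w" and v: "v \<in> X"
  shows "0 \<le> form u v / 2 + (\<integral>x. a x * h (u x) * v x \<partial>lebesgue) - (\<integral>x. f x * v x \<partial>lebesgue)"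
proof -
  obtain A B where A: "AE x in lebesgue. \<bar>u x\<bar> \<le> A" and B: "AE x in lebesgue. \<bar>v x\<bar> \<le> B"
    using u v by (auto simp: X_def)
  have um[measurable]: "u \<in> borel_measurable lebesgue" and vm[measurable]: "v \<in> borel_measurable lebesgue"
    using u v by (auto intro: X_measurable)
  \<comment> \<open>The steps lie in (0, 1], so all perturbed functions share the bound A +
    B.\<close>
  define t where "t n = 1 / real (Suc n)" for n
  have t: "0 < t n" "t n \<le> 1" for n by (auto simp: t_def)
  define w where "w n x = u x + t n * v x" for n x
  have wm[measurable]: "w n \<in> borel_measurable lebesgue" for n unfolding w_def by measurable
  have wX: "w n \<in> X" for n using X_lincomb[OF u v, of 1 "t n"] by (simp add: w_def[abs_def])
  have wB: "AE x in lebesgue. \<bar>w n x\<bar> \<le> A + B" for n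
    using A B
  proof eventually_elim
    case (elim x)
    have "\<bar>t n * v x\<bar> \<le> 1 * \<bar>v x\<bar>"
      unfolding abs_mult using t[of n] by (intro mult_right_mono) auto
    then show ?case using elim unfolding w_def by linarith
  qed
  define I where "I n = (\<integral>x. a x * h (w n x) * v x \<partial>lebesgue)" for n
  have Iint: "integrable lebesgue (\<lambda>x. a x * h (w n x) * v x)" for n
    by (rule integrable_reaction[OF wm wB vm B])
  have fint: "integrable lebesgue (\<lambda>x. f x * v x)" by (rule integrable_mult_bounded[OF f_int vm B])
  have step: "0 \<le> form u v / 2 + t n * form v v / 4 + I n - (\<integral>x. f x * v x \<partial>lebesgue)" for n
  proof -
    have "potential (w n) - potential u
       = (\<integral>x. (a x * H (w n x) - f x * w n x) - (a x * H (u x) - f x * u x) \<partial>lebesgue)"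
      unfolding potential_def
      using integrable_potential[OF wm wB] integrable_potential[OF um A] by simp
    \<comment> \<open>The tangent at the perturbed point \<open>w n x\<close> bounds the increase of
      \<open>H\<close> from above; the tangent at \<open>u x\<close> would bound it from
      below.\<close>
    also have "\<dots> \<le> (\<integral>x. t n * (a x * h (w n x) * v x - f x * v x) \<partial>lebesgue)"
    proof (rule integral_mono_AE)
      show "integrable lebesgue (\<lambda>x. (a x * H (w n x) - f x * w n x) - (a x * H (u x) - f x * u x))"
        using integrable_potential[OF wm wB] integrable_potential[OF um A] by simp
      show "integrable lebesgue (\<lambda>x. t n * (a x * h (w n x) * v x - f x * v x))"
        using Iint fint by simp
      show "AE x in lebesgue. (a x * H (w n x) - f x * w n x) - (a x * H (u x) - f x * u x)
          \<le> t n * (a x * h (w n x) * v x - f x * v x)"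
        using a_nonneg
      proof eventually_elim
        case (elim x)
        have "a x * (H (w n x) - H (u x)) \<le> a x * (h (w n x) * (w n x - u x))"
          using elim H_subgradient by (intro mult_left_mono)
        then show ?case by (simp add: w_def algebra_simps)
      qed
    qed
    also have "\<dots> = t n * (I n - (\<integral>x. f x * v x \<partial>lebesgue))"
      unfolding I_def using Iint fint by simp
    finally have "potential (w n) - potential u \<le> t n * (I n - (\<integral>x. f x * v x \<partial>lebesgue))" .
    moreover have "form (w n) (w n) = form u u + 2 * t n * form u v + (t n)\<^sup>2 * form v v"
      unfolding w_def using u v by (intro form_add_scaled X_Hs)
    then have "(form (w n) (w n) - form u u) / 4 = t n * (form u v / 2 + t n * form v v / 4)"
      by (simp add: power2_eq_square field_simps)
    moreover have "0 \<le> (form (w n) (w n) - form u u) / 4 + (potential (w n) - potential u)"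
      using min[OF wX, of n] by (simp add: energy_def field_simps)
    ultimately have "0 \<le> t n * (form u v / 2 + t n * form v v / 4) + t n * (I n - (\<integral>x. f x * v x \<partial>lebesgue))"
      by linarith
    then have "0 \<le> t n * (form u v / 2 + t n * form v v / 4 + I n - (\<integral>x. f x * v x \<partial>lebesgue))"
      by (simp only: distrib_left[symmetric] add_diff_eq)
    then show ?thesis using t(1)[of n] by (simp add: zero_le_mult_iff)
  qed
  have t0: "t \<longlonglongrightarrow> 0" unfolding t_def using LIMSEQ_inverse_real_of_nat by (simp add: inverse_eq_divide)
  have "I \<longlonglongrightarrow> (\<integral>x. a x * h (u x) * v x \<partial>lebesgue)"
  proof -
    obtain M where M: "0 \<le> M" "\<And>y. \<bar>y\<bar> \<le> A + B \<Longrightarrow> \<bar>h y\<bar> \<le> M"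
      using continuous_bounded_on_interval[OF h_cont] by blast
    show ?thesis
      unfolding I_def
    proof (rule integral_dominated_convergence[where w="\<lambda>x. \<bar>a x\<bar> * (M * \<bar>B\<bar>)"])
      show "integrable lebesgue (\<lambda>x. \<bar>a x\<bar> * (M * \<bar>B\<bar>))" using a_int by auto
      show "AE x in lebesgue. (\<lambda>n. a x * h (w n x) * v x) \<longlonglongrightarrow> a x * h (u x) * v x"
      proof (rule AE_I2)
        fix x
        have "(\<lambda>n. u x + t n * v x) \<longlonglongrightarrow> u x + 0 * v x" by (intro tendsto_intros t0)
        then have "(\<lambda>n. w n x) \<longlonglongrightarrow> u x" by (simp add: w_def)
        moreover have "isCont h (u x)" using h_cont by (simp add: continuous_on_eq_continuous_at)
        ultimately show "(\<lambda>n. a x * h (w n x) * v x) \<longlonglongrightarrow> a x * h (u x) * v x"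
          by (intro tendsto_intros isCont_tendsto_compose[of _ h])
      qed
      show "AE x in lebesgue. norm (a x * h (w n x) * v x) \<le> \<bar>a x\<bar> * (M * \<bar>B\<bar>)" for n
        using wB[of n] B
      proof eventually_elim
        case (elim x)
        then have "\<bar>a x\<bar> * (\<bar>h (w n x)\<bar> * \<bar>v x\<bar>) \<le> \<bar>a x\<bar> * (M * \<bar>B\<bar>)"
          using M by (intro mult_left_mono mult_mono) auto
        then show ?case by (simp add: abs_mult mult.assoc)
      qed
    qed measurable
  qed
  then have "(\<lambda>n. form u v / 2 + t n * form v v / 4 + I n - (\<integral>x. f x * v x \<partial>lebesgue))
      \<longlonglongrightarrow> form u v / 2 + 0 * form v v / 4 + (\<integral>x. a x * h (u x) * v x \<partial>lebesgue) - (\<integral>x. f x * v x \<partial>lebesgue)"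
    by (intro tendsto_intros t0) auto
  from LIMSEQ_le_const[OF this, of 0] step show ?thesis by auto
qed

text \<open>The weak equation without the integrability clauses of \<open>weak_solution\<close>: for
  members of \<open>X\<close> those hold automatically.\<close>

definition solves :: "('a \<Rightarrow> real) \<Rightarrow> bool" where
  "solves u \<longleftrightarrow> u \<in> X \<and> (\<forall>v\<in>X.
     form u v / 2 + (\<integral>x. a x * h (u x) * v x \<partial>lebesgue) = (\<integral>x. f x * v x \<partial>lebesgue))"

lemma solution_exists:
  obtains u where "solves u" "AE x in lebesgue. \<bar>u x\<bar> \<le> k"
    "form u u \<le> 2 * k * (\<integral>x. \<bar>f x\<bar> \<partial>lebesgue)"
proof -
  obtain u where u: "u \<in> admissible" and min: "\<And>w. w \<in> X \<Longrightarrow> energy u \<le> energy w"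
    using energy_minimizer by blast
  have uX: "u \<in> X" using u admissible_subset_X by auto
  have uk: "AE x in lebesgue. \<bar>u x\<bar> \<le> k" using u by (simp add: admissible_def)
  have um: "u \<in> borel_measurable lebesgue" using uX by (rule X_measurable)
  have eq: "form u v / 2 + (\<integral>x. a x * h (u x) * v x \<partial>lebesgue) = (\<integral>x. f x * v x \<partial>lebesgue)"
    if v: "v \<in> X" for v
  proof -
    \<comment> \<open>The variation is nonnegative in both directions v and -v and linear in the
      direction, hence it is zero.\<close>
    have v': "(\<lambda>x. - v x) \<in> X" using X_lincomb[OF v v, of "-1" 0] by simp
    have "(\<lambda>p. incr u p * incr (\<lambda>x. - v x) p * kernel p) = (\<lambda>p. - (incr u p * incr v p * kernel p))"
      by (auto simp: incr_def algebra_simps)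
    then have "form u (\<lambda>x. - v x) = - form u v" by (simp add: form_def)
    then show ?thesis
      using minimizer_variation_nonneg[OF uX min v] minimizer_variation_nonneg[OF uX min v'] by simp
  qed
  have "form u u / 2 \<le> (\<integral>x. f x * u x \<partial>lebesgue)"
  proof -
    have "0 \<le> (\<integral>x. a x * h (u x) * u x \<partial>lebesgue)"
    proof (rule integral_nonneg_AE)
      show "AE x in lebesgue. 0 \<le> a x * h (u x) * u x"
        using a_nonneg by eventually_elim (use h_mult_nonneg[of _ 0] in \<open>auto simp: mult.assoc\<close>)
    qed
    then show ?thesis using eq[OF uX] by simp
  qed
  also have "\<dots> \<le> (\<integral>x. k * \<bar>f x\<bar> \<partial>lebesgue)"
  proof (rule integral_mono_AE)
    show "integrable lebesgue (\<lambda>x. f x * u x)" by (rule integrable_mult_bounded[OF f_int um uk])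
    show "AE x in lebesgue. f x * u x \<le> k * \<bar>f x\<bar>"
      using uk
    proof eventually_elim
      case (elim x)
      have "f x * u x \<le> \<bar>f x\<bar> * \<bar>u x\<bar>" by (metis abs_ge_self abs_mult)
      also have "\<dots> \<le> \<bar>f x\<bar> * k" using elim by (intro mult_left_mono) auto
      finally show ?case by (simp add: mult.commute)
    qed
  qed (use f_int in auto)
  finally have "form u u \<le> 2 * k * (\<integral>x. \<bar>f x\<bar> \<partial>lebesgue)" by simp
  with eq uX uk show ?thesis by (intro that[of u]) (auto simp: solves_def)
qed

text \<open>Monotonicity of \<open>h\<close> and the sign of \<open>a\<close> make the difference of
  the reaction terms nonnegative, which forces the form of the difference to vanish. The Poincare
  inequality turns this into equality a.e. on the whole space.\<close>

lemma solution_unique: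
  assumes u: "solves u" and v: "solves v"
  shows "AE x in lebesgue. u x = v x"
proof -
  have uX: "u \<in> X" and vX: "v \<in> X" using u v by (auto simp: solves_def)
  define w where "w x = u x - v x" for x
  have wX: "w \<in> X" using X_lincomb[OF uX vX, of 1 "-1"] by (simp add: w_def[abs_def])
  obtain A B C where A: "AE x in lebesgue. \<bar>u x\<bar> \<le> A" and B: "AE x in lebesgue. \<bar>v x\<bar> \<le> B"
    and C: "AE x in lebesgue. \<bar>w x\<bar> \<le> C" using uX vX wX by (auto simp: X_def)
  note m = X_measurable[OF uX] X_measurable[OF vX] X_measurable[OF wX]
  have "form u w / 2 + (\<integral>x. a x * h (u x) * w x \<partial>lebesgue) = form v w / 2 + (\<integral>x. a x * h (v x) * w x \<partial>lebesgue)"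
    using u v wX by (simp add: solves_def)
  moreover have "form w w = form u w - form v w"
  proof -
    have "(\<lambda>p. incr w p * incr w p * kernel p) = (\<lambda>p. incr u p * incr w p * kernel p - incr v p * incr w p * kernel p)"
      by (auto simp: incr_def w_def algebra_simps)
    then show ?thesis
      unfolding form_def using integrable_form[OF uX[THEN X_Hs] wX[THEN X_Hs]] integrable_form[OF vX[THEN X_Hs] wX[THEN X_Hs]]
      by simp
  qed
  moreover have "(\<integral>x. a x * h (v x) * w x \<partial>lebesgue) \<le> (\<integral>x. a x * h (u x) * w x \<partial>lebesgue)"
  proof (rule integral_mono_AE)
    show "integrable lebesgue (\<lambda>x. a x * h (v x) * w x)" by (rule integrable_reaction[OF m(2) B m(3) C])
    show "integrable lebesgue (\<lambda>x. a x * h (u x) * w x)" by (rule integrable_reaction[OF m(1) A m(3) C])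
    show "AE x in lebesgue. a x * h (v x) * w x \<le> a x * h (u x) * w x"
      using a_nonneg
    proof eventually_elim
      case (elim x)
      have "0 \<le> a x * ((h (u x) - h (v x)) * w x)"
        unfolding w_def by (rule mult_nonneg_nonneg[OF elim h_mult_nonneg])
      then show ?case by (simp add: algebra_simps)
    qed
  qed
  ultimately have "form w w \<le> 0" by linarith
  then have "form w w = 0" using form_self_nonneg[of w] by linarith
  moreover have "w \<in> Hs0 s \<Omega>" using wX by (simp add: X_def)
  moreover obtain P where "\<And>w. w \<in> Hs0 s \<Omega> \<Longrightarrow> (\<integral>\<^sup>+x. ennreal ((w x)\<^sup>2) \<partial>lebesgue) \<le> ennreal (P * form w w)"
    using poincare by blast
  ultimately have "(\<integral>\<^sup>+x. ennreal ((w x)\<^sup>2) \<partial>lebesgue) \<le> ennreal (P * 0)" by metis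
  then have "(\<integral>\<^sup>+x. ennreal ((w x)\<^sup>2) \<partial>lebesgue) = 0" by simp
  then have "AE x in lebesgue. ennreal ((w x)\<^sup>2) = 0"
    using m(3) by (subst (asm) nn_integral_0_iff_AE) auto
  then show ?thesis by eventually_elim (simp add: w_def ennreal_eq_0_iff)
qed

end

section \<open>Existence and uniqueness\<close>

text \<open>The energy estimate uses the nonnegative integral, so that finiteness is part of the
  claim. Solutions are functions rather than classes, hence uniqueness is equality almost
  everywhere.\<close>

theorem theorem1p1:
  fixes \<Omega> :: "'a::euclidean_space set"
    and K :: "'a \<Rightarrow> 'a \<Rightarrow> real"
    and s c C Q :: real and \<rho> \<gamma> :: ereal
    and h :: "real \<Rightarrow> real" and a f :: "'a \<Rightarrow> real"
  assumes s: "0 < s" "s < 1"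
    and \<Omega>: "open \<Omega>" "bounded \<Omega>" "lipschitz_boundary \<Omega>"
    and K_meas: "(\<lambda>p. K (fst p) (snd p)) \<in> borel_measurable (lebesgue :: ('a \<times> 'a) measure)"
    and cC: "0 < c" "0 < C" and \<rho>: "0 < \<rho>"
    and K_nonneg: "\<forall>x z. 0 \<le> K x z"
    and K_lower: "\<forall>x z. x \<noteq> z \<longrightarrow>
        c * (if ereal (norm (x - z)) < \<rho> then 1 else 0) / norm (x - z) powr (real DIM('a) + 2 * s) \<le> K x z"
    and K_upper: "\<forall>x z. x \<noteq> z \<longrightarrow> K x z \<le> C / norm (x - z) powr (real DIM('a) + 2 * s)"
    and K_sym: "\<forall>x z. K x z = K z x"
    and h: "continuous_on UNIV h" "\<forall>t. h (- t) = - h t" "strict_mono h"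
    and \<gamma>: "((\<lambda>t. ereal (h t)) \<longlongrightarrow> \<gamma>) at_top"
    and af: "set_integrable lebesgue \<Omega> a" "set_integrable lebesgue \<Omega> f"
    and Q: "0 < Q" "ereal Q < \<gamma>"
    and fa: "AE x in lebesgue. x \<in> \<Omega> \<longrightarrow> \<bar>f x\<bar> \<le> Q * a x"
  shows "(\<exists>u. weak_solution s K a h f \<Omega> u \<and> u \<in> Linf \<Omega> \<and>
            (AE x in lebesgue. x \<in> \<Omega> \<longrightarrow> \<bar>u x\<bar> \<le> inv h Q) \<and>
            (\<integral>\<^sup>+ p. ennreal ((u (fst p) - u (snd p))\<^sup>2 * K (fst p) (snd p))
                \<partial>(lebesgue :: ('a \<times> 'a) measure))
              \<le> ennreal (2 * inv h Q * ((LINT x:\<Omega>|lebesgue. \<bar>f x\<bar>) + Q * (LINT x:\<Omega>|lebesgue. \<bar>a x\<bar>))))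
       \<and> (\<forall>u1 u2. weak_solution s K a h f \<Omega> u1 \<and> u1 \<in> Linf \<Omega> \<and>
                  weak_solution s K a h f \<Omega> u2 \<and> u2 \<in> Linf \<Omega> \<longrightarrow>
                  (AE x in lebesgue. u1 x = u2 x))"
proof -
  have h0: "h 0 = 0" using h(2)[rule_format, of 0] by simp
  \<comment> \<open>The limit \<gamma> exceeds Q, so \<open>h\<close> passes Q somewhere, and
    \<open>h 0 = 0\<close> lies below Q; the intermediate value theorem between 0 and
    \<open>max N 0\<close> yields \<open>k\<close>. The maximum covers a negative
    \<open>N\<close>.\<close>
  have "\<forall>\<^sub>F t in at_top. ereal Q < ereal (h t)" by (rule order_tendstoD(1)[OF \<gamma> Q(2)])
  then obtain N where N: "\<And>t. N \<le> t \<Longrightarrow> Q < h t" by (auto simp: eventually_at_top_linorder)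
  obtain k where k: "0 \<le> k" "h k = Q"
    using IVT'[of h 0 Q "max N 0"] h0 Q(1) N[of "max N 0"] continuous_on_subset[OF h(1)]
    by (auto simp: less_imp_le)
  have k_pos: "0 < k" using k h0 Q(1) by (cases "k = 0") auto
  have inv_k: "inv h Q = k" using k(2) strict_mono_imp_inj_on[OF h(3)] by (auto intro: inv_f_eq)
  \<comment> \<open>A finite \<rho> serves as \<open>r\<close> itself; for infinite \<rho> the value
    1 is taken.\<close>
  obtain r where r: "0 < r" "ereal r \<le> \<rho>"
    using \<rho> by (cases \<rho>) (auto intro: that[of 1])
  obtain H where H: "\<And>t. (H has_real_derivative h t) (at t)"
    using einterval_antiderivative[of "- \<infinity>" \<infinity> h] h(1)
    by (auto simp: continuous_on_eq_continuous_at has_real_derivative_iff_has_vector_derivative)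
  \<comment> \<open>Extension by 0 makes the bound of the source by Q times the coefficient hold
    a.e. on the whole space and turns integrals over \<Omega> into integrals over
    everything.\<close>
  define a' f' where "a' x = indicator \<Omega> x * a x" and "f' x = indicator \<Omega> x * f x" for x
  interpret semilinear_problem \<Omega> K s c C r h H a' f' Q k
  proof
    show "c / norm (x - z) powr (real DIM('a) + 2 * s) \<le> K x z" if "x \<noteq> z" "norm (x - z) < r" for x z
    proof -
      have "ereal (norm (x - z)) < \<rho>" using that(2) r(2) by (metis ereal_less(3) less_ereal.simps(1) order_less_le_trans)
      then show ?thesis using K_lower that(1) by fastforce
    qed
    show "integrable lebesgue a'" "integrable lebesgue f'"
      using af by (simp_all add: a'_def[abs_def] f'_def[abs_def] set_integrable_def)
    show "AE x in lebesgue. \<bar>f' x\<bar> \<le> Q * a' x"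
      using fa by eventually_elim (auto simp: a'_def f'_def indicator_def)
  qed (use s \<Omega> K_meas cC r K_nonneg K_upper h H Q k k_pos in \<open>auto simp: strict_mono_mono\<close>)
  have X_iff: "v \<in> X \<longleftrightarrow> v \<in> Hs0 s \<Omega> \<inter> Linf \<Omega>" for v
    unfolding X_def using LinfI Hs0_Linf_bounded by blast
  have form: "(\<integral>p. (u (fst p) - u (snd p)) * (v (fst p) - v (snd p)) * K (fst p) (snd p) \<partial>(lebesgue :: ('a \<times> 'a) measure))
      = form u v" for u v
    by (simp add: form_def incr_def kernel_def)
  have reaction: "(LINT x:\<Omega>|lebesgue. a x * h (u x) * v x) = (\<integral>x. a' x * h (u x) * v x \<partial>lebesgue)" for u v
    by (simp add: set_lebesgue_integral_def a'_def mult.assoc)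
  have source: "(LINT x:\<Omega>|lebesgue. f x * v x) = (\<integral>x. f' x * v x \<partial>lebesgue)" for v
    by (simp add: set_lebesgue_integral_def f'_def mult.assoc)
  have weak_iff: "weak_solution s K a h f \<Omega> u \<and> u \<in> Linf \<Omega> \<longleftrightarrow> solves u" for u
  proof
    assume "weak_solution s K a h f \<Omega> u \<and> u \<in> Linf \<Omega>"
    then show "solves u"
      unfolding weak_solution_def solves_def X_iff[symmetric] form reaction source by (auto simp: X_iff)
  next
    assume u: "solves u"
    then have uX: "u \<in> X" by (simp add: solves_def)
    then obtain A where A: "AE x in lebesgue. \<bar>u x\<bar> \<le> A" by (auto simp: X_def)
    have "integrable lebesgue (\<lambda>p. (u (fst p) - u (snd p)) * (v (fst p) - v (snd p)) * K (fst p) (snd p))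
        \<and> set_integrable lebesgue \<Omega> (\<lambda>x. a x * h (u x) * v x) \<and> set_integrable lebesgue \<Omega> (\<lambda>x. f x * v x)"
      if v: "v \<in> X" for v
    proof -
      obtain B where B: "AE x in lebesgue. \<bar>v x\<bar> \<le> B" using v by (auto simp: X_def)
      have "(\<lambda>x. indicator \<Omega> x *\<^sub>R (a x * h (u x) * v x)) = (\<lambda>x. a' x * h (u x) * v x)"
        "(\<lambda>x. indicator \<Omega> x *\<^sub>R (f x * v x)) = (\<lambda>x. f' x * v x)"
        by (auto simp: a'_def f'_def mult.assoc)
      then show ?thesis
        using integrable_form[OF uX[THEN X_Hs] v[THEN X_Hs]]
          integrable_reaction[OF X_measurable[OF uX] A X_measurable[OF v] B]
          integrable_mult_bounded[OF f_int X_measurable[OF v] B]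
        by (simp add: incr_def kernel_def set_integrable_def)
    qed
    then show "weak_solution s K a h f \<Omega> u \<and> u \<in> Linf \<Omega>"
      using u uX unfolding weak_solution_def X_iff[symmetric] form reaction source
      by (auto simp: solves_def X_iff)
  qed
  obtain u where u: "solves u" "AE x in lebesgue. \<bar>u x\<bar> \<le> k"
    "form u u \<le> 2 * k * (\<integral>x. \<bar>f' x\<bar> \<partial>lebesgue)"
    using solution_exists by blast
  have "u \<in> Hs s" using u(1) by (auto simp: solves_def intro: X_Hs)
  then have "(\<integral>\<^sup>+p. ennreal ((u (fst p) - u (snd p))\<^sup>2 * K (fst p) (snd p)) \<partial>(lebesgue :: ('a \<times> 'a) measure))
      = ennreal (form u u)"
    using nn_integral_form by (simp add: incr_def kernel_def)
  \<comment> \<open>The form is already bounded by the part with \<open>f\<close>; the nonnegative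
    term with \<open>a\<close> is added.\<close>
  also have "\<dots> \<le> ennreal (2 * k * ((LINT x:\<Omega>|lebesgue. \<bar>f x\<bar>) + Q * (LINT x:\<Omega>|lebesgue. \<bar>a x\<bar>)))"
  proof (rule ennreal_leI)
    have "(LINT x:\<Omega>|lebesgue. \<bar>f x\<bar>) = (\<integral>x. \<bar>f' x\<bar> \<partial>lebesgue)"
      by (simp add: set_lebesgue_integral_def f'_def abs_mult)
    moreover have "0 \<le> Q * (LINT x:\<Omega>|lebesgue. \<bar>a x\<bar>)"
      using Q(1) by (simp add: set_lebesgue_integral_def)
    ultimately have "2 * k * (\<integral>x. \<bar>f' x\<bar> \<partial>lebesgue)
        \<le> 2 * k * ((LINT x:\<Omega>|lebesgue. \<bar>f x\<bar>) + Q * (LINT x:\<Omega>|lebesgue. \<bar>a x\<bar>))"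
      using k_pos by (intro mult_left_mono) auto
    then show "form u u \<le> 2 * k * ((LINT x:\<Omega>|lebesgue. \<bar>f x\<bar>) + Q * (LINT x:\<Omega>|lebesgue. \<bar>a x\<bar>))"
      using u(3) by linarith
  qed
  finally have energy_le: "(\<integral>\<^sup>+p. ennreal ((u (fst p) - u (snd p))\<^sup>2 * K (fst p) (snd p)) \<partial>(lebesgue :: ('a \<times> 'a) measure))
      \<le> ennreal (2 * inv h Q * ((LINT x:\<Omega>|lebesgue. \<bar>f x\<bar>) + Q * (LINT x:\<Omega>|lebesgue. \<bar>a x\<bar>)))"
    by (simp only: inv_k)
  have u_le: "AE x in lebesgue. x \<in> \<Omega> \<longrightarrow> \<bar>u x\<bar> \<le> inv h Q"
    using u(2) unfolding inv_k by eventually_elim simp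
  show ?thesis
  proof (intro conjI allI impI)
    show "\<exists>u. weak_solution s K a h f \<Omega> u \<and> u \<in> Linf \<Omega> \<and>
            (AE x in lebesgue. x \<in> \<Omega> \<longrightarrow> \<bar>u x\<bar> \<le> inv h Q) \<and>
            (\<integral>\<^sup>+ p. ennreal ((u (fst p) - u (snd p))\<^sup>2 * K (fst p) (snd p))
                \<partial>(lebesgue :: ('a \<times> 'a) measure))
              \<le> ennreal (2 * inv h Q * ((LINT x:\<Omega>|lebesgue. \<bar>f x\<bar>) + Q * (LINT x:\<Omega>|lebesgue. \<bar>a x\<bar>)))"
      using u(1)[folded weak_iff] u_le energy_le by blast
  next
    fix u1 u2
    assume "weak_solution s K a h f \<Omega> u1 \<and> u1 \<in> Linf \<Omega> \<and> weak_solution s K a h f \<Omega> u2 \<and> u2 \<in> Linf \<Omega>"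
    then have "solves u1" "solves u2" using weak_iff by blast+
    then show "AE x in lebesgue. u1 x = u2 x" by (rule solution_unique)
  qed
qed

end
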